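(* Let $G$ be a finitely generated, non-elementary, Gromov hyperbolic group and let $\phi: G\to G$ be a hyperbolic automorphism. Then the Reidemeister number $R(\phi)$ is infinite.
   Context: For an endomorphism $\phi:G\to G$, two elements $\alpha,\alpha'\in G$ are called $\phi$-conjugate if there exists $\gamma\in G$ with $\alpha'=\gamma\alpha\phi(\gamma)^{-1}$; the Reidemeister number $R(\phi)\in\mathbb{N}\cup\{\infty\}$ is the number of $\phi$-conjugacy classes. A group is non-elementary if it is not virtually cyclic. Fix a word metric $\|\cdot\|$ on $G$ with respect to a finite generating set. An automorphism $\phi$ of $G$ is hyperbolic if there exist an integer $m\ge 1$ and a real number $\lambda>1$ such that for all $g\in G$, $\max(\|\phi^m(g)\|,\|\phi^{-m}(g)\|)\ge\lambda\|g\|$. *)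

theory Defs
  imports "HOL-Algebra.Algebra" Complex_Main
begin

definition fin_gen_set :: "('a, 'b) monoid_scheme \<Rightarrow> 'a set \<Rightarrow> bool" where
  "fin_gen_set G S \<longleftrightarrow> finite S \<and> S \<subseteq> carrier G \<and> generate G S = carrier G"

definition list_prod :: "('a, 'b) monoid_scheme \<Rightarrow> 'a list \<Rightarrow> 'a" where
  "list_prod G l = foldr (\<lambda>x y. x \<otimes>\<^bsub>G\<^esub> y) l \<one>\<^bsub>G\<^esub>"

definition word_length :: "('a, 'b) monoid_scheme \<Rightarrow> 'a set \<Rightarrow> 'a \<Rightarrow> nat" where
  "word_length G S g = (LEAST n. \<exists>l. length l = n \<and> set l \<subseteq> S \<union> (\<lambda>s. inv\<^bsub>G\<^esub> s) ` S
                                     \<and> list_prod G l = g)"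

definition word_dist :: "('a, 'b) monoid_scheme \<Rightarrow> 'a set \<Rightarrow> 'a \<Rightarrow> 'a \<Rightarrow> real" where
  "word_dist G S x y = real (word_length G S (inv\<^bsub>G\<^esub> x \<otimes>\<^bsub>G\<^esub> y))"

definition gromov_prod :: "('a, 'b) monoid_scheme \<Rightarrow> 'a set \<Rightarrow> 'a \<Rightarrow> 'a \<Rightarrow> 'a \<Rightarrow> real" where
  "gromov_prod G S w x y = (word_dist G S x w + word_dist G S y w - word_dist G S x y) / 2"

text \<open>Gromov hyperbolic group: the group with the word metric of the finite
  generating set S is a delta-hyperbolic metric space (Gromov's four-point
  condition) for some delta.\<close>
definition gromov_hyperbolic_group :: "('a, 'b) monoid_scheme \<Rightarrow> 'a set \<Rightarrow> bool" where
  "gromov_hyperbolic_group G S \<longleftrightarrow>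
     (\<exists>\<delta>::real. \<delta> \<ge> 0 \<and> (\<forall>w\<in>carrier G. \<forall>x\<in>carrier G. \<forall>y\<in>carrier G. \<forall>z\<in>carrier G.
        gromov_prod G S w x y \<ge> min (gromov_prod G S w x z) (gromov_prod G S w y z) - \<delta>))"

definition virtually_cyclic :: "('a, 'b) monoid_scheme \<Rightarrow> bool" where
  "virtually_cyclic G \<longleftrightarrow> (\<exists>h\<in>carrier G. finite (rcosets\<^bsub>G\<^esub> (generate G {h})))"

definition non_elementary :: "('a, 'b) monoid_scheme \<Rightarrow> bool" where
  "non_elementary G \<longleftrightarrow> \<not> virtually_cyclic G"

definition hyperbolic_aut :: "('a, 'b) monoid_scheme \<Rightarrow> 'a set \<Rightarrow> ('a \<Rightarrow> 'a) \<Rightarrow> bool" where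
  "hyperbolic_aut G S \<phi> \<longleftrightarrow>
     (\<exists>m::nat. \<exists>c::real. m \<ge> 1 \<and> c > 1 \<and>
        (\<forall>g\<in>carrier G. max (real (word_length G S ((\<phi> ^^ m) g)))
                             (real (word_length G S ((inv_into (carrier G) \<phi> ^^ m) g)))
                         \<ge> c * real (word_length G S g)))"

definition twisted_conj :: "('a, 'b) monoid_scheme \<Rightarrow> ('a \<Rightarrow> 'a) \<Rightarrow> ('a \<times> 'a) set" where
  "twisted_conj G \<phi> = {(a, a'). a \<in> carrier G \<and> a' \<in> carrier G \<and>
      (\<exists>c\<in>carrier G. a' = c \<otimes>\<^bsub>G\<^esub> a \<otimes>\<^bsub>G\<^esub> inv\<^bsub>G\<^esub> (\<phi> c))}"

definition reidemeister_classes :: "('a, 'b) monoid_scheme \<Rightarrow> ('a \<Rightarrow> 'a) \<Rightarrow> 'a set set" where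
  "reidemeister_classes G \<phi> = carrier G // twisted_conj G \<phi>"

end

theory Submission
  imports Defs
begin

text \<open>
  Write \<open>(x | y)\<close> for the Gromov product at \<open>\<one>\<close>. If there are finitely many
  \<open>\<phi>\<close>-conjugacy classes, then every \<open>g\<close> has an almost fixed point: some \<open>c\<close> at bounded
  distance from \<open>g \<phi>(c)\<close>. Choose elements \<open>g\<close> of length about \<open>n\<close> such that
  \<open>(g\<inverse> | \<phi>(g))\<close> is \<open>o(n)\<close> while every \<open>\<psi>(g)\<close>, \<open>\<psi>\<close> an automorphism, has length at least
  \<open>\<kappa> n - O(1)\<close> with \<open>\<kappa>\<close> independent of \<open>\<psi>\<close>. Since \<open>\<phi>\<close> is hyperbolic, \<open>c\<close> has length \<open>O(n)\<close>.
  By the four-point condition \<open>(g\<inverse> | \<phi>(c))\<close> or \<open>(\<phi>(g) | \<phi>(c))\<close> is \<open>o(n)\<close>. In the first case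
  automorphisms preserve smallness of Gromov products up to \<open>o(n)\<close>, so \<open>\<phi>\<^sup>i(c)\<close> is longer
  than \<open>\<phi>\<^sup>i\<^sup>+\<^sup>1(c)\<close> by \<open>\<kappa> n - o(n)\<close> for each \<open>i\<close>; then \<open>c\<close> has length at least
  \<open>k \<kappa> n - o(n)\<close> for every \<open>k\<close>, a contradiction. The second case is the first one for the inverse of \<open>\<phi>\<close>.

  The elements \<open>g\<close> are products of two factors out of \<open>h\<^sup>n\<close>, \<open>h\<^sup>-\<^sup>n\<close>, \<open>z h\<^sup>\<plusminus>\<^sup>n\<close>, where \<open>h\<close> has
  infinite order and \<open>z\<close> is a long shortest representative of a coset of \<open>\<langle>h\<rangle>\<close>, which
  exists because the group is not virtually cyclic. The uniform \<open>\<kappa>\<close> exists because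
  translation lengths are bounded away from zero.
\<close>

section \<open>Word metrics and Gromov products\<close>

locale fin_gen_group = group G for G (structure) +
  fixes S :: "'a set"
  assumes fin_gen: "fin_gen_set G S"
begin

lemma inv_mult_cancel [simp]:
  assumes "x \<in> carrier G" "y \<in> carrier G"
  shows "inv x \<otimes> (x \<otimes> y) = y" "x \<otimes> (inv x \<otimes> y) = y"
  using assms by (simp_all add: m_assoc[symmetric])

abbreviation letters :: "'a set" where
  "letters \<equiv> S \<union> (\<lambda>s. inv s) ` S"

abbreviation wl :: "'a \<Rightarrow> nat" where
  "wl \<equiv> word_length G S"

abbreviation len :: "'a \<Rightarrow> real" where
  "len x \<equiv> real (wl x)"

text \<open>The Gromov product based at \<open>\<one>\<close>; by left invariance other base points reduce to it.\<close>
definition gp :: "'a \<Rightarrow> 'a \<Rightarrow> real" where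
  "gp x y = (len x + len y - len (inv x \<otimes> y)) / 2"

section \<open>Words in the generators, word length and geodesics\<close>

lemma finite_letters: "finite letters"
  using fin_gen by (auto simp: fin_gen_set_def)

lemma letters_closed: "letters \<subseteq> carrier G"
  using fin_gen by (auto simp: fin_gen_set_def)

lemma list_prod_Nil [simp]: "list_prod G [] = \<one>"
  and list_prod_Cons [simp]: "list_prod G (a # l) = a \<otimes> list_prod G l"
  by (simp_all add: list_prod_def)

lemma list_prod_closed: "set l \<subseteq> letters \<Longrightarrow> list_prod G l \<in> carrier G"
  using letters_closed by (induction l) auto

lemma list_prod_append:
  assumes "set l \<subseteq> letters" "set l' \<subseteq> letters"
  shows "list_prod G (l @ l') = list_prod G l \<otimes> list_prod G l'"
  using assms
proof (induction l)
  case Nil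
  then show ?case using list_prod_closed[of l'] by (simp add: list_prod_def)
next
  case (Cons a l)
  have "a \<in> carrier G" "list_prod G l \<in> carrier G" "list_prod G l' \<in> carrier G"
    using Cons.prems letters_closed list_prod_closed[of l] list_prod_closed[of l'] by auto
  then show ?case using Cons by (simp add: list_prod_def m_assoc)
qed

lemma ex_word:
  assumes "x \<in> carrier G"
  shows "\<exists>l. set l \<subseteq> letters \<and> list_prod G l = x"
proof -
  have "x \<in> generate G S" using assms fin_gen by (simp add: fin_gen_set_def)
  then show ?thesis
  proof (induction rule: generate.induct)
    case one
    show ?case by (intro exI[of _ "[]"]) (simp add: list_prod_def)
  next
    case (incl h)
    then show ?case using letters_closed by (intro exI[of _ "[h]"]) (auto simp: list_prod_def)
  next
    case (inv h)
    then show ?case using letters_closed by (intro exI[of _ "[inv h]"]) (auto simp: list_prod_def)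
  next
    case (eng h1 h2)
    then obtain l1 l2 where "set l1 \<subseteq> letters" "list_prod G l1 = h1"
      "set l2 \<subseteq> letters" "list_prod G l2 = h2" by blast
    then show ?case using list_prod_append[of l1 l2] by (intro exI[of _ "l1 @ l2"]) simp
  qed
qed

lemma ex_geodesic_word:
  assumes "x \<in> carrier G"
  obtains l where "length l = wl x" "set l \<subseteq> letters" "list_prod G l = x"
proof -
  have "\<exists>n l. length l = n \<and> set l \<subseteq> letters \<and> list_prod G l = x" using ex_word[OF assms] by auto
  then have "\<exists>l. length l = wl x \<and> set l \<subseteq> letters \<and> list_prod G l = x"
    unfolding word_length_def by (rule LeastI_ex)
  then show ?thesis using that by blast
qed

lemma wl_list_prod_le: "set l \<subseteq> letters \<Longrightarrow> wl (list_prod G l) \<le> length l"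
  unfolding word_length_def by (rule Least_le) auto

lemma wl_one [simp]: "wl \<one> = 0"
  using wl_list_prod_le[of "[]"] by (simp add: list_prod_def)

lemma wl_mult_le:
  assumes "x \<in> carrier G" "y \<in> carrier G"
  shows "wl (x \<otimes> y) \<le> wl x + wl y"
proof -
  obtain l where "length l = wl x" "set l \<subseteq> letters" "list_prod G l = x"
    using ex_geodesic_word[OF assms(1)] .
  moreover obtain l' where "length l' = wl y" "set l' \<subseteq> letters" "list_prod G l' = y"
    using ex_geodesic_word[OF assms(2)] .
  ultimately show ?thesis using wl_list_prod_le[of "l @ l'"] list_prod_append[of l l'] by simp
qed

lemma list_prod_rev_inv:
  assumes "set l \<subseteq> letters"
  shows "set (map (\<lambda>s. inv s) (rev l)) \<subseteq> letters"
    and "list_prod G (map (\<lambda>s. inv s) (rev l)) = inv (list_prod G l)"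
proof -
  have cl: "inv s \<in> letters" if "s \<in> letters" for s
    using that letters_closed by auto
  have 1: "set (map (\<lambda>s. inv s) (rev l)) \<subseteq> letters" if "set l \<subseteq> letters" for l
    using that cl by (simp only: set_map set_rev) blast
  show "set (map (\<lambda>s. inv s) (rev l)) \<subseteq> letters" using 1[OF assms] .
  show "list_prod G (map (\<lambda>s. inv s) (rev l)) = inv (list_prod G l)"
    using assms
  proof (induction l)
    case Nil
    then show ?case by (simp add: list_prod_def)
  next
    case (Cons a l)
    have a: "a \<in> carrier G" "list_prod G l \<in> carrier G" "a \<in> letters" "set l \<subseteq> letters"
      using Cons.prems letters_closed list_prod_closed[of l] by auto
    have "list_prod G (map (\<lambda>s. inv s) (rev (a # l)))
        = list_prod G (map (\<lambda>s. inv s) (rev l)) \<otimes> list_prod G [inv a]"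
      using list_prod_append[OF 1[OF a(4)], of "[inv a]"] cl[OF a(3)] by simp
    also have "\<dots> = inv (list_prod G l) \<otimes> inv a"
      using Cons.IH a by (simp add: list_prod_def)
    also have "\<dots> = inv (list_prod G (a # l))"
      using a by (simp add: list_prod_def inv_mult_group)
    finally show ?case .
  qed
qed

lemma wl_inv [simp]:
  assumes "x \<in> carrier G"
  shows "wl (inv x) = wl x"
proof -
  have le: "wl (inv y) \<le> wl y" if y: "y \<in> carrier G" for y
  proof -
    obtain l where "length l = wl y" "set l \<subseteq> letters" "list_prod G l = y"
      using ex_geodesic_word[OF y] .
    then show ?thesis
      using wl_list_prod_le[OF list_prod_rev_inv(1)[of l]] list_prod_rev_inv(2)[of l] by simp
  qed
  show ?thesis using le[OF assms] le[of "inv x"] assms by simp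
qed

text \<open>A finite alphabet has finitely many words of bounded length. This later yields long
  elements of an infinite group and leaves only finitely many short elements to treat.\<close>

lemma finite_ball: "finite {x \<in> carrier G. len x \<le> r}"
proof (rule finite_subset)
  let ?W = "{l. set l \<subseteq> letters \<and> length l \<le> nat \<lfloor>r\<rfloor>}"
  show "{x \<in> carrier G. len x \<le> r} \<subseteq> list_prod G ` ?W"
  proof
    fix x assume x: "x \<in> {x \<in> carrier G. len x \<le> r}"
    then obtain l where "length l = wl x" "set l \<subseteq> letters" "list_prod G l = x"
      using ex_geodesic_word by blast
    moreover have "wl x \<le> nat \<lfloor>r\<rfloor>" using x by (simp add: le_nat_floor)
    ultimately show "x \<in> list_prod G ` ?W" by force
  qed
  show "finite (list_prod G ` ?W)" using finite_lists_length_le[OF finite_letters] by simp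
qed

text \<open>The prefixes of a shortest word for \<open>x\<close> form a geodesic. It is continued by
  the constant \<open>x\<close>, so that chains along it may have more than \<open>wl x\<close>
  steps.\<close>

lemma ex_geodesic:
  assumes "x \<in> carrier G"
  obtains p :: "nat \<Rightarrow> 'a" where "p 0 = \<one>" "\<And>i. wl x \<le> i \<Longrightarrow> p i = x" "\<And>i. p i \<in> carrier G"
    "\<And>i j. i \<le> j \<Longrightarrow> j \<le> wl x \<Longrightarrow> wl (inv (p i) \<otimes> p j) = j - i"
proof -
  obtain l where l: "length l = wl x" "set l \<subseteq> letters" "list_prod G l = x"
    using ex_geodesic_word[OF assms] .
  define p where "p i = list_prod G (take i l)" for i
  have tk: "set (take i l') \<subseteq> letters" "set (drop i l') \<subseteq> letters"
    if "set l' \<subseteq> letters" for i and l' :: "'a list"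
    using subset_trans[OF set_take_subset that] subset_trans[OF set_drop_subset that] by blast+
  have cl: "p i \<in> carrier G" for i
    unfolding p_def using tk(1)[OF l(2)] by (rule list_prod_closed)
  have up: "wl (inv (p i) \<otimes> p j) \<le> j - i" if "i \<le> j" "j \<le> wl x" for i j
  proof -
    let ?d = "drop i (take j l)"
    have "take j l = take i l @ ?d"
      using append_take_drop_id[of i "take j l"] that by (simp add: min_absorb1)
    then have "p j = p i \<otimes> list_prod G ?d"
      using list_prod_append[OF tk(1)[OF l(2), of i] tk(2)[OF tk(1)[OF l(2)], of i j]] by (simp add: p_def)
    then have "inv (p i) \<otimes> p j = list_prod G ?d"
      using cl list_prod_closed[OF tk(2)[OF tk(1)[OF l(2)]]] by simp
    then show ?thesis
      using wl_list_prod_le[OF tk(2)[OF tk(1)[OF l(2)]], of i j] that l(1) by simp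
  qed
  have 0: "p 0 = \<one>" by (simp add: p_def list_prod_def)
  have stop: "p i = x" if "wl x \<le> i" for i using that l by (simp add: p_def)
  have "wl (inv (p i) \<otimes> p j) = j - i" if ij: "i \<le> j" "j \<le> wl x" for i j
  proof -
    \<comment> \<open>A middle piece shorter than \<open>j - i\<close> would give a word for
      \<open>x\<close> of length below \<open>wl x\<close>.\<close>
    have "x = p i \<otimes> ((inv (p i) \<otimes> p j) \<otimes> (inv (p j) \<otimes> x))"
      using cl assms by (simp add: m_assoc)
    then have "wl x \<le> wl (p i) + (wl (inv (p i) \<otimes> p j) + wl (inv (p j) \<otimes> x))"
      using wl_mult_le[of "p i" "(inv (p i) \<otimes> p j) \<otimes> (inv (p j) \<otimes> x)"]
        wl_mult_le[of "inv (p i) \<otimes> p j" "inv (p j) \<otimes> x"] cl assms by simp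
    moreover have "wl (p i) \<le> i" using up[of 0 i] ij 0 cl by simp
    moreover have "wl (inv (p j) \<otimes> x) \<le> wl x - j" using up[of j "wl x"] ij stop by simp
    ultimately show ?thesis using up[OF ij] ij by linarith
  qed
  then show ?thesis using that 0 stop cl by blast
qed

lemma ex_split:
  assumes "x \<in> carrier G" "n \<le> wl x"
  obtains p q where "p \<in> carrier G" "q \<in> carrier G" "x = p \<otimes> q" "wl p = n" "wl q = wl x - n"
proof -
  obtain p :: "nat \<Rightarrow> 'a" where p: "p 0 = \<one>" "\<And>i. wl x \<le> i \<Longrightarrow> p i = x" "\<And>i. p i \<in> carrier G"
    "\<And>i j. i \<le> j \<Longrightarrow> j \<le> wl x \<Longrightarrow> wl (inv (p i) \<otimes> p j) = j - i"
    using ex_geodesic[OF assms(1)] by blast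
  show ?thesis
  proof (rule that[of "p n" "inv (p n) \<otimes> x"])
    show "wl (p n) = n" using p(4)[of 0 n] p(1,3) assms by simp
    show "wl (inv (p n) \<otimes> x) = wl x - n" using p(4)[of n "wl x"] p(2)[of "wl x"] assms by simp
    show "x = p n \<otimes> (inv (p n) \<otimes> x)" using p(3) assms by simp
  qed (use p(3) assms in auto)
qed

section \<open>Triangle inequalities and Gromov products\<close>

lemma len_mult_le:
  "x \<in> carrier G \<Longrightarrow> y \<in> carrier G \<Longrightarrow> len (x \<otimes> y) \<le> len x + len y"
  using wl_mult_le of_nat_mono by fastforce

lemma gp_commute: "x \<in> carrier G \<Longrightarrow> y \<in> carrier G \<Longrightarrow> gp x y = gp y x"
proof -
  assume "x \<in> carrier G" "y \<in> carrier G"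
  then have "wl (inv x \<otimes> y) = wl (inv y \<otimes> x)"
    using wl_inv[of "inv x \<otimes> y"] by (simp add: inv_mult_group)
  then show ?thesis by (simp add: gp_def)
qed

text \<open>So \<open>gp (inv x) y\<close> is half the cancellation in \<open>x \<otimes> y\<close>;
  this reading is used throughout.\<close>

lemma len_mult: "x \<in> carrier G \<Longrightarrow> len (x \<otimes> y) = len x + len y - 2 * gp (inv x) y"
  by (simp add: gp_def field_simps)

text \<open>In the triangle \<open>\<one>\<close>, \<open>x\<close>, \<open>x \<otimes> y\<close>
  the Gromov products at the two ends of the side from \<open>\<one>\<close> to \<open>x\<close> add
  up to its length; the one at \<open>x\<close>, translated by \<open>inv x\<close>, is
  \<open>gp (inv x) y\<close>.\<close>

lemma gp_mult_right:
  "x \<in> carrier G \<Longrightarrow> y \<in> carrier G \<Longrightarrow> gp x (x \<otimes> y) = len x - gp (inv x) y"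
  by (simp add: gp_def field_simps)

lemma gp_nonneg: "x \<in> carrier G \<Longrightarrow> y \<in> carrier G \<Longrightarrow> 0 \<le> gp x y"
  using len_mult_le[of "inv x" y] by (simp add: gp_def)

lemma gp_le_left: "x \<in> carrier G \<Longrightarrow> y \<in> carrier G \<Longrightarrow> gp x y \<le> len x"
  using len_mult_le[of x "inv x \<otimes> y"] by (simp add: gp_def)

lemma gp_one [simp]: "x \<in> carrier G \<Longrightarrow> gp \<one> x = 0" "x \<in> carrier G \<Longrightarrow> gp x \<one> = 0"
  by (simp_all add: gp_def)

lemma len_diff_le:
  "x \<in> carrier G \<Longrightarrow> y \<in> carrier G \<Longrightarrow> z \<in> carrier G \<Longrightarrow>
    len (inv x \<otimes> z) \<le> len (inv x \<otimes> y) + len (inv y \<otimes> z)"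
  using len_mult_le[of "inv x \<otimes> y" "inv y \<otimes> z"]
  by (simp add: m_assoc)

lemma gp_translate_le:
  assumes "w \<in> carrier G" "x \<in> carrier G" "y \<in> carrier G"
  shows "gp (w \<otimes> x) (w \<otimes> y) \<le> len w + gp x y"
proof -
  have "inv (w \<otimes> x) \<otimes> (w \<otimes> y) = inv x \<otimes> y"
    using assms by (simp add: inv_mult_group m_assoc)
  then show ?thesis
    using len_mult_le[of w x] len_mult_le[of w y] assms by (simp add: gp_def field_simps)
qed

section \<open>Lipschitz bounds for automorphisms\<close>

lemma finite_image_bound:
  assumes "finite F" shows "\<exists>C. \<forall>x\<in>F. len x \<le> C"
  using bdd_above_finite[OF finite_imageI[OF assms, of len]] by (auto simp: bdd_above_def)

lemma iso_lipschitz: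
  assumes "\<psi> \<in> iso G G"
  shows "\<exists>K\<ge>1. \<forall>x\<in>carrier G. len (\<psi> x) \<le> K * len x"
proof -
  obtain C where C: "\<And>s. s \<in> letters \<Longrightarrow> len (\<psi> s) \<le> C"
    using finite_image_bound[OF finite_imageI[OF finite_letters, of \<psi>]] by auto
  define K where "K = max 1 C"
  interpret hom: group_hom G G \<psi>
    using assms by unfold_locales (auto simp: iso_def)
  have "len (\<psi> (list_prod G l)) \<le> K * length l" if "set l \<subseteq> letters" for l
    using that
  proof (induction l)
    case Nil
    then show ?case by (simp add: list_prod_def)
  next
    case (Cons a l)
    have a: "a \<in> carrier G" "list_prod G l \<in> carrier G" "a \<in> letters" "set l \<subseteq> letters"
      using Cons.prems letters_closed list_prod_closed[of l] by auto
    have "len (\<psi> (list_prod G (a # l))) = len (\<psi> a \<otimes> \<psi> (list_prod G l))"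
      using a by (simp add: list_prod_def)
    also have "\<dots> \<le> len (\<psi> a) + len (\<psi> (list_prod G l))"
      using a by (intro len_mult_le) auto
    also have "\<dots> \<le> K + K * length l"
      using Cons.IH[OF a(4)] C[OF a(3)] by (simp add: K_def)
    finally show ?case by (simp add: algebra_simps)
  qed
  then have "len (\<psi> x) \<le> K * len x" if "x \<in> carrier G" for x
    using ex_geodesic_word[OF that] by (metis (no_types))
  moreover have "K \<ge> 1" by (simp add: K_def)
  ultimately show ?thesis by blast
qed

lemma iso_len_le:
  assumes \<psi>: "\<psi> \<in> iso G G"
  shows "\<exists>K\<ge>1. \<forall>x\<in>carrier G. len x \<le> K * len (\<psi> x)"
proof -
  obtain K where K: "K \<ge> 1" "\<forall>x\<in>carrier G. len (inv_into (carrier G) \<psi> x) \<le> K * len x"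
    using iso_lipschitz[OF iso_set_sym[OF \<psi>]] by blast
  have "len x \<le> K * len (\<psi> x)" if "x \<in> carrier G" for x
  proof -
    have "inv_into (carrier G) \<psi> (\<psi> x) = x" "\<psi> x \<in> carrier G"
      using \<psi> that by (auto simp: iso_def bij_betw_def hom_def)
    then show ?thesis using K(2) by metis
  qed
  then show ?thesis using K(1) by blast
qed

end

section \<open>Sublinear error terms\<close>

text \<open>Encodes the one-sided bound f(n) \<le> o(n) on \<open>A\<close>; very negative values
  are allowed. The index set is variable because the final argument passes to an infinite
  subset.\<close>

definition sublinear_on :: "nat set \<Rightarrow> (nat \<Rightarrow> real) \<Rightarrow> bool" where
  "sublinear_on A f \<longleftrightarrow> (\<forall>\<epsilon>>0. \<exists>B. \<forall>n\<in>A. f n \<le> \<epsilon> * real n + B)"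

lemma sublinear_onD:
  assumes "sublinear_on A f" "\<epsilon> > 0"
  obtains B where "B \<ge> 0" "\<And>n. n \<in> A \<Longrightarrow> f n \<le> \<epsilon> * real n + B"
proof -
  obtain B where "\<forall>n\<in>A. f n \<le> \<epsilon> * real n + B"
    using assms unfolding sublinear_on_def by blast
  then show ?thesis using that[of "max B 0"] by fastforce
qed

lemma sublinear_on_subset: "sublinear_on A f \<Longrightarrow> B \<subseteq> A \<Longrightarrow> sublinear_on B f"
  unfolding sublinear_on_def by blast

lemma sublinear_on_mono:
  "sublinear_on A f \<Longrightarrow> (\<And>n. n \<in> A \<Longrightarrow> g n \<le> f n) \<Longrightarrow> sublinear_on A g"
  unfolding sublinear_on_def by (meson order_trans)

lemma sublinear_on_const [simp]: "sublinear_on A (\<lambda>_. c)"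
  unfolding sublinear_on_def by (auto intro!: exI[of _ c])

lemma sublinear_on_add:
  assumes "sublinear_on A f" "sublinear_on A g"
  shows "sublinear_on A (\<lambda>n. f n + g n)"
  unfolding sublinear_on_def
proof safe
  fix \<epsilon> :: real assume "\<epsilon> > 0"
  then obtain B C where B: "\<And>n. n \<in> A \<Longrightarrow> f n \<le> \<epsilon>/2 * real n + B"
    and C: "\<And>n. n \<in> A \<Longrightarrow> g n \<le> \<epsilon>/2 * real n + C"
    using sublinear_onD[OF assms(1), of "\<epsilon>/2"] sublinear_onD[OF assms(2), of "\<epsilon>/2"]
    by (metis half_gt_zero)
  have "f n + g n \<le> \<epsilon> * real n + (B + C)" if "n \<in> A" for n
    using B[OF that] C[OF that] by (simp add: field_simps)
  then show "\<exists>B. \<forall>n\<in>A. f n + g n \<le> \<epsilon> * real n + B" by blast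
qed

lemma sublinear_on_cmult:
  assumes "sublinear_on A f" "c \<ge> 0"
  shows "sublinear_on A (\<lambda>n. c * f n)"
  unfolding sublinear_on_def
proof safe
  fix \<epsilon> :: real assume e: "\<epsilon> > 0"
  then obtain B where B: "\<And>n. n \<in> A \<Longrightarrow> f n \<le> \<epsilon>/(c+1) * real n + B"
    using sublinear_onD[OF assms(1), of "\<epsilon>/(c+1)"] assms(2)
    by (metis add_nonneg_pos divide_pos_pos zero_less_one)
  have "c * f n \<le> \<epsilon> * real n + c * B" if "n \<in> A" for n
  proof -
    have "c * f n \<le> c * (\<epsilon>/(c+1) * real n + B)"
      using B[OF that] assms(2) by (rule mult_left_mono)
    also have "\<dots> = (c/(c+1)) * (\<epsilon> * real n) + c * B" by (simp add: field_simps)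
    also have "(c/(c+1)) * (\<epsilon> * real n) \<le> 1 * (\<epsilon> * real n)"
      using e assms(2) by (intro mult_right_mono) auto
    finally show ?thesis by simp
  qed
  then show "\<exists>B. \<forall>n\<in>A. c * f n \<le> \<epsilon> * real n + B" by blast
qed

lemma sublinear_on_max:
  assumes "sublinear_on A f" "sublinear_on A g"
  shows "sublinear_on A (\<lambda>n. max (f n) (g n))"
  unfolding sublinear_on_def
proof safe
  fix \<epsilon> :: real assume "\<epsilon> > 0"
  then obtain B C where B: "\<And>n. n \<in> A \<Longrightarrow> f n \<le> \<epsilon> * real n + B"
    and C: "\<And>n. n \<in> A \<Longrightarrow> g n \<le> \<epsilon> * real n + C"
    using sublinear_onD[OF assms(1)] sublinear_onD[OF assms(2)] by metis
  have "max (f n) (g n) \<le> \<epsilon> * real n + max B C" if "n \<in> A" for n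
    using B[OF that] C[OF that] by linarith
  then show "\<exists>B. \<forall>n\<in>A. max (f n) (g n) \<le> \<epsilon> * real n + B" by blast
qed

lemma not_sublinear_on_linear:
  assumes "infinite A" "\<kappa> > 0"
  shows "\<not> sublinear_on A (\<lambda>n. \<kappa> * real n)"
proof
  assume "sublinear_on A (\<lambda>n. \<kappa> * real n)"
  then obtain B where B: "\<And>n. n \<in> A \<Longrightarrow> \<kappa> * real n \<le> \<kappa>/2 * real n + B"
    using sublinear_onD[of A "\<lambda>n. \<kappa> * real n" "\<kappa>/2"] assms(2) by auto
  have "real n \<le> 2 * B / \<kappa>" if "n \<in> A" for n
    using B[OF that] assms(2) by (simp add: field_simps)
  then have "A \<subseteq> {n. n \<le> nat \<lfloor>2 * B / \<kappa>\<rfloor>}" by (auto simp: le_nat_floor)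
  then show False using assms(1) finite_subset by blast
qed

text \<open>For large \<open>n\<close> the linear term exceeds \<open>h n\<close>, so the minimum is
  \<open>f n\<close>; the finitely many other \<open>n\<close> cost a constant. It serves to read
  off one entry of a five-point estimate.\<close>

lemma sublinear_on_min_linear:
  assumes min: "\<And>n. n \<in> A \<Longrightarrow> min (f n) (\<kappa> * real n - g n) \<le> h n" and "\<kappa> > 0"
    and "sublinear_on A g" "sublinear_on A h"
  shows "sublinear_on A f"
proof -
  obtain B where B: "B \<ge> 0" "\<And>n. n \<in> A \<Longrightarrow> g n + h n \<le> \<kappa>/2 * real n + B"
    using sublinear_onD[OF sublinear_on_add[OF assms(3,4)], of "\<kappa>/2"] assms(2) by auto
  \<comment> \<open>Beyond \<open>N\<close> one has \<open>\<kappa>/2 * real n > B\<close>, hence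
    \<open>\<kappa> * real n - g n > h n\<close>.\<close>
  define N where "N = nat \<lceil>2 * B / \<kappa>\<rceil>"
  define M where "M = Max (f ` {..N})"
  have "f n \<le> max (h n) M" if n: "n \<in> A" for n
  proof (cases "n \<le> N")
    case True
    then have "f n \<le> M" by (auto simp: M_def)
    then show ?thesis by simp
  next
    case False
    then have "real n > 2 * B / \<kappa>" unfolding N_def by linarith
    then have "\<kappa> * real n > 2 * B" using assms(2) by (simp add: field_simps)
    then have "\<kappa> * real n - g n > h n" using B(2)[OF n] by linarith
    then show ?thesis using min[OF n] by linarith
  qed
  then show ?thesis
    using sublinear_on_mono[OF sublinear_on_max[OF assms(4) sublinear_on_const]] by blast
qed

section \<open>Sequences of linearly bounded length\<close>

context fin_gen_group
begin

text \<open>The summand 1 makes bounded sequences linearly bounded even at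
  \<open>n = 0\<close>.\<close>

definition lin_bounded :: "nat set \<Rightarrow> (nat \<Rightarrow> 'a) \<Rightarrow> bool" where
  "lin_bounded A x \<longleftrightarrow> (\<exists>\<Lambda>. \<forall>n\<in>A. x n \<in> carrier G \<and> len (x n) \<le> \<Lambda> * (real n + 1))"

lemma lin_boundedD:
  assumes "lin_bounded A x"
  obtains \<Lambda> where "\<Lambda> \<ge> 1" "\<And>n. n \<in> A \<Longrightarrow> x n \<in> carrier G"
    "\<And>n. n \<in> A \<Longrightarrow> len (x n) \<le> \<Lambda> * (real n + 1)"
proof -
  obtain \<Lambda> where \<Lambda>: "\<And>n. n \<in> A \<Longrightarrow> x n \<in> carrier G"
    "\<And>n. n \<in> A \<Longrightarrow> len (x n) \<le> \<Lambda> * (real n + 1)"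
    using assms unfolding lin_bounded_def by blast
  have "\<Lambda> * (real n + 1) \<le> max \<Lambda> 1 * (real n + 1)" for n
    by (intro mult_right_mono) auto
  then show ?thesis using that[of "max \<Lambda> 1"] \<Lambda> by (meson max.cobounded2 order_trans)
qed

lemma lin_bounded_subset: "lin_bounded A x \<Longrightarrow> B \<subseteq> A \<Longrightarrow> lin_bounded B x"
  unfolding lin_bounded_def by blast

lemma lin_bounded_mult:
  assumes "lin_bounded A x" "lin_bounded A y"
  shows "lin_bounded A (\<lambda>n. x n \<otimes> y n)"
proof -
  obtain \<Lambda> where x: "\<And>n. n \<in> A \<Longrightarrow> x n \<in> carrier G"
    "\<And>n. n \<in> A \<Longrightarrow> len (x n) \<le> \<Lambda> * (real n + 1)"
    using lin_boundedD[OF assms(1)] by metis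
  obtain M where y: "\<And>n. n \<in> A \<Longrightarrow> y n \<in> carrier G"
    "\<And>n. n \<in> A \<Longrightarrow> len (y n) \<le> M * (real n + 1)"
    using lin_boundedD[OF assms(2)] by metis
  have "len (x n \<otimes> y n) \<le> (\<Lambda> + M) * (real n + 1)" if "n \<in> A" for n
    using len_mult_le[OF x(1)[OF that] y(1)[OF that]] x(2)[OF that] y(2)[OF that]
    by (simp only: distrib_right)
  then show ?thesis using x(1) y(1) unfolding lin_bounded_def by blast
qed

lemma lin_bounded_inv:
  "lin_bounded A x \<Longrightarrow> lin_bounded A (\<lambda>n. inv (x n))"
  unfolding lin_bounded_def using inv_closed wl_inv by (metis (no_types))

lemma lin_bounded_iso:
  assumes "lin_bounded A x" "\<psi> \<in> iso G G"
  shows "lin_bounded A (\<lambda>n. \<psi> (x n))"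
proof -
  obtain \<Lambda> where x: "\<And>n. n \<in> A \<Longrightarrow> x n \<in> carrier G"
    "\<And>n. n \<in> A \<Longrightarrow> len (x n) \<le> \<Lambda> * (real n + 1)"
    using lin_boundedD[OF assms(1)] by metis
  obtain K where K: "K \<ge> 1" "\<forall>x\<in>carrier G. len (\<psi> x) \<le> K * len x"
    using iso_lipschitz[OF assms(2)] by blast
  have "len (\<psi> (x n)) \<le> (K * \<Lambda>) * (real n + 1)" if "n \<in> A" for n
  proof -
    have "len (\<psi> (x n)) \<le> K * len (x n)" using K(2) x(1)[OF that] by blast
    also have "\<dots> \<le> K * (\<Lambda> * (real n + 1))" using x(2)[OF that] K(1) by (intro mult_left_mono) auto
    finally show ?thesis by (simp add: mult.assoc)
  qed
  moreover have "\<psi> (x n) \<in> carrier G" if "n \<in> A" for n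
    using assms(2) x(1)[OF that] by (auto simp: iso_def hom_def)
  ultimately show ?thesis unfolding lin_bounded_def by blast
qed

lemma lin_bounded_bounded:
  assumes "\<And>n. n \<in> A \<Longrightarrow> x n \<in> carrier G" "\<And>n. n \<in> A \<Longrightarrow> len (x n) \<le> C"
  shows "lin_bounded A x"
proof -
  have "len (x n) \<le> max C 0 * (real n + 1)" if "n \<in> A" for n
  proof -
    have "max C 0 * 1 \<le> max C 0 * (real n + 1)" by (intro mult_left_mono) auto
    then show ?thesis using assms(2)[OF that] by linarith
  qed
  then show ?thesis using assms(1) unfolding lin_bounded_def by blast
qed

end

section \<open>Gromov products under automorphisms\<close>

text \<open>In \<open>four_point\<close> the element \<open>z\<close> is a middle term: if
  \<open>x\<close> starts like \<open>z\<close> and \<open>z\<close> like \<open>y\<close>, then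
  \<open>x\<close> starts like \<open>y\<close>, with loss \<delta>.\<close>

locale hyperbolic_group = fin_gen_group G S for G (structure) and S +
  fixes \<delta> :: real
  assumes delta_nonneg: "0 \<le> \<delta>"
    and four_point: "\<lbrakk>x \<in> carrier G; y \<in> carrier G; z \<in> carrier G\<rbrakk>
      \<Longrightarrow> min (gp x z) (gp z y) - \<delta> \<le> gp x y"
begin

lemma five_point:
  assumes "x \<in> carrier G" "y \<in> carrier G" "z \<in> carrier G" "w \<in> carrier G"
  shows "min (gp x y) (min (gp y z) (gp z w)) - 2 * \<delta> \<le> gp x w"
  using four_point[of x w y] four_point[of y w z] assms delta_nonneg by linarith

text \<open>Bisection uses the four-point condition once per level, so a chain of
  \<open>2 ^ k\<close> steps loses only \<open>real k * \<delta>\<close>.\<close>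

lemma gp_chain:
  assumes "\<And>i. c i \<in> carrier G" "\<And>i. i < 2 ^ k \<Longrightarrow> t < gp (c i) (c (Suc i))"
  shows "t - real k * \<delta> < gp (c 0) (c (2 ^ k))"
  using assms
proof (induction k arbitrary: c)
  case 0
  then show ?case using "0.prems"(2)[of 0] by simp
next
  case (Suc k)
  have "t - real k * \<delta> < gp (c 0) (c (2 ^ k))" using Suc by simp
  moreover have "t - real k * \<delta> < gp (c (2 ^ k + 0)) (c (2 ^ k + 2 ^ k))"
    using Suc.prems by (intro Suc.IH[of "\<lambda>i. c (2 ^ k + i)"]) auto
  ultimately have "t - real k * \<delta> - \<delta> < gp (c 0) (c (2 ^ k + 2 ^ k))"
    using four_point[of "c 0" "c (2 ^ k + 2 ^ k)" "c (2 ^ k)"] Suc.prems(1) by (simp; linarith)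
  then show ?case by (simp add: algebra_simps mult_2)
qed

text \<open>A path of images under \<open>\<psi>\<close> passes logarithmically close to every point on a geodesic
  between its endpoints.\<close>
lemma image_path_near:
  assumes \<psi>: "\<psi> \<in> iso G G" and K: "\<And>x. x \<in> carrier G \<Longrightarrow> len (\<psi> x) \<le> K * len x" "K \<ge> 0"
    and p: "p 0 = \<one>" "\<And>i. wl a \<le> i \<Longrightarrow> p i = a" "\<And>i. p i \<in> carrier G"
      "\<And>i. i < wl a \<Longrightarrow> wl (inv (p i) \<otimes> p (Suc i)) = 1"
    and z: "z \<in> carrier G" and k: "wl a \<le> 2 ^ k" and e: "gp (inv z) (inv z \<otimes> \<psi> a) \<le> e"
  shows "\<exists>i \<le> wl a. len (inv z \<otimes> \<psi> (p i)) \<le> e + K + real k * \<delta>"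
proof (rule ccontr)
  interpret hom: group_hom G G \<psi>
    using \<psi> by unfold_locales (auto simp: iso_def)
  assume neg: "\<not> ?thesis"
  \<comment> \<open>The image path seen from \<open>z\<close>. If it stayed far away, consecutive
    points would have Gromov product above \<open>e + real k * \<delta>\<close>, and chaining them
    would contradict the bound \<open>e\<close> for the endpoints.\<close>
  define c where "c i = inv z \<otimes> \<psi> (p i)" for i
  have c: "c i \<in> carrier G" for i using p z by (simp add: c_def)
  have far: "e + K + real k * \<delta> < len (c i)" for i
  proof (cases "i \<le> wl a")
    case False
    then have eq: "c i = c (wl a)" using p(2) by (simp add: c_def)
    have "\<not> len (c (wl a)) \<le> e + K + real k * \<delta>" using neg unfolding c_def by blast
    then show ?thesis using eq by simp
  next
    case True
    then have "\<not> len (c i) \<le> e + K + real k * \<delta>" using neg unfolding c_def by blast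
    then show ?thesis by simp
  qed
  have step: "len (inv (c i) \<otimes> c (Suc i)) \<le> K" for i
  proof -
    have "inv (c i) \<otimes> c (Suc i) = \<psi> (inv (p i) \<otimes> p (Suc i))"
      using p z by (simp add: c_def inv_mult_group m_assoc)
    moreover have "wl (inv (p i) \<otimes> p (Suc i)) \<le> 1"
      using p(4)[of i] p(2)[of i] p(2)[of "Suc i"] p(3) by (cases "i < wl a") auto
    then have "K * len (inv (p i) \<otimes> p (Suc i)) \<le> K"
      using K(2) by (metis le_numeral_extra(4) mult_left_mono mult.right_neutral of_nat_1 of_nat_mono)
    ultimately show ?thesis using K(1)[of "inv (p i) \<otimes> p (Suc i)"] p(3) by simp
  qed
  have "e + real k * \<delta> < gp (c i) (c (Suc i))" for i
  proof -
    have "len (c i) \<le> len (c (Suc i)) + len (inv (c i) \<otimes> c (Suc i))"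
    proof -
      have "c i = c (Suc i) \<otimes> inv (inv (c i) \<otimes> c (Suc i))"
        using c by (simp add: inv_mult_group)
      then show ?thesis
        using len_mult_le[of "c (Suc i)" "inv (inv (c i) \<otimes> c (Suc i))"] c
        by (metis inv_closed m_closed wl_inv)
    qed
    then show ?thesis using far[of i] step[of i] by (simp add: gp_def field_simps)
  qed
  then have "e + real k * \<delta> - real k * \<delta> < gp (c 0) (c (2 ^ k))"
    using gp_chain[of c k "e + real k * \<delta>"] c by blast
  moreover have "c 0 = inv z" "c (2 ^ k) = inv z \<otimes> \<psi> a"
    using p z k by (simp_all add: c_def)
  ultimately show False using e by simp
qed

text \<open>By \<open>geo\<close>, \<open>\<one>\<close> lies on a geodesic from \<open>x\<close> to
  \<open>y\<close>. A point \<open>z\<close> at distance about \<open>D\<close> on a geodesic to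
  \<open>\<psi> x\<close> is near points \<open>\<psi> (p i)\<close> and \<open>\<psi> (q j)\<close>
  of both image paths. Then \<open>p i\<close> and \<open>q j\<close> are close to each other, hence
  to \<open>\<one>\<close> between them, which bounds \<open>len z\<close> and so
  \<open>D\<close>.\<close>

lemma image_gp_geodesic:
  assumes \<psi>: "\<psi> \<in> iso G G"
    and K: "\<And>x. x \<in> carrier G \<Longrightarrow> len (\<psi> x) \<le> K * len x"
      "\<And>x. x \<in> carrier G \<Longrightarrow> len x \<le> K * len (\<psi> x)" "K \<ge> 0"
    and x: "x \<in> carrier G" "wl x \<le> 2 ^ k" and y: "y \<in> carrier G" "wl y \<le> 2 ^ k"
    and geo: "gp x y = 0"
  shows "gp (\<psi> x) (\<psi> y) \<le> (2 * K * K + 1) * (\<delta> + K + real k * \<delta>) + 1"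
proof -
  interpret hom: group_hom G G \<psi>
    using \<psi> by unfold_locales (auto simp: iso_def)
  define D where "D = gp (\<psi> x) (\<psi> y)"
  define E where "E = \<delta> + K + real k * \<delta>"
  have "0 \<le> D" "D \<le> len (\<psi> x)" using gp_nonneg gp_le_left x y by (simp_all add: D_def)
  then have "nat \<lfloor>D\<rfloor> \<le> wl (\<psi> x)" by linarith
  then obtain z z' where z: "z \<in> carrier G" "z' \<in> carrier G" "\<psi> x = z \<otimes> z'" "wl z = nat \<lfloor>D\<rfloor>"
    "wl z' = wl (\<psi> x) - nat \<lfloor>D\<rfloor>"
    using ex_split[of "\<psi> x"] x by (metis hom.hom_closed)
  have lz: "len z \<le> D" "D \<le> len z + 1" using z(4) \<open>0 \<le> D\<close> by linarith+
  have gz: "gp (inv z) z' = 0"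
    using len_mult[OF z(1), of z'] z \<open>nat \<lfloor>D\<rfloor> \<le> wl (\<psi> x)\<close> by simp
  have ex: "gp (inv z) (inv z \<otimes> \<psi> x) \<le> \<delta>" using z gz delta_nonneg by simp
  \<comment> \<open>Geodesics to \<open>\<psi> x\<close> and \<open>\<psi> y\<close> stay close up
    to distance \<open>D\<close>, so \<open>z\<close> lies nearly on the second as well.\<close>
  have ey: "gp (inv z) (inv z \<otimes> \<psi> y) \<le> \<delta>"
  proof -
    have "gp z (\<psi> x) = len z" using gp_mult_right[OF z(1,2)] gz z(3) by simp
    then have "len z - \<delta> \<le> gp z (\<psi> y)"
      using four_point[of z "\<psi> y" "\<psi> x"] z x y lz(1) by (simp add: D_def)
    moreover have "gp (inv z) (inv z \<otimes> \<psi> y) = len z - gp z (\<psi> y)"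
      using gp_mult_right[of "inv z" "\<psi> y"] z y by simp
    ultimately show ?thesis by simp
  qed
  obtain p :: "nat \<Rightarrow> 'a" where p: "p 0 = \<one>" "\<And>i. wl x \<le> i \<Longrightarrow> p i = x" "\<And>i. p i \<in> carrier G"
    "\<And>i j. i \<le> j \<Longrightarrow> j \<le> wl x \<Longrightarrow> wl (inv (p i) \<otimes> p j) = j - i"
    using ex_geodesic[OF x(1)] by blast
  obtain q :: "nat \<Rightarrow> 'a" where q: "q 0 = \<one>" "\<And>i. wl y \<le> i \<Longrightarrow> q i = y" "\<And>i. q i \<in> carrier G"
    "\<And>i j. i \<le> j \<Longrightarrow> j \<le> wl y \<Longrightarrow> wl (inv (q i) \<otimes> q j) = j - i"
    using ex_geodesic[OF y(1)] by blast
  have "\<exists>i \<le> wl x. len (inv z \<otimes> \<psi> (p i)) \<le> \<delta> + K + real k * \<delta>"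
    by (rule image_path_near[where K = K]) (use \<psi> K p z x ex in auto)
  then obtain i where i: "i \<le> wl x" "len (inv z \<otimes> \<psi> (p i)) \<le> E" by (auto simp: E_def)
  have "\<exists>i \<le> wl y. len (inv z \<otimes> \<psi> (q i)) \<le> \<delta> + K + real k * \<delta>"
    by (rule image_path_near[where K = K]) (use \<psi> K q z y ey in auto)
  then obtain j where j: "j \<le> wl y" "len (inv z \<otimes> \<psi> (q j)) \<le> E" by (auto simp: E_def)
  have "len (inv (\<psi> (p i)) \<otimes> \<psi> (q j)) \<le> len (inv (\<psi> (p i)) \<otimes> z) + len (inv z \<otimes> \<psi> (q j))"
    using len_diff_le[of "\<psi> (p i)" z "\<psi> (q j)"] p q z by simp
  also have "wl (inv (\<psi> (p i)) \<otimes> z) = wl (inv z \<otimes> \<psi> (p i))"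
    using wl_inv[of "inv z \<otimes> \<psi> (p i)"] p z by (simp add: inv_mult_group)
  finally have "len (\<psi> (inv (p i) \<otimes> q j)) \<le> 2 * E" using i(2) j(2) p q by simp
  then have "K * len (\<psi> (inv (p i) \<otimes> q j)) \<le> K * (2 * E)"
    using K(3) by (rule mult_left_mono)
  then have 1: "len (inv (p i) \<otimes> q j) \<le> K * (2 * E)"
    using K(2)[of "inv (p i) \<otimes> q j"] p(3) q(3) by simp
  \<comment> \<open>The route from \<open>x\<close> to \<open>y\<close> through \<open>p i\<close>
    and \<open>q j\<close> is no shorter than the one through \<open>\<one>\<close>, so
    \<open>i + j\<close> is at most the distance from \<open>p i\<close> to
    \<open>q j\<close>.\<close>
  have "len x + len y = len (inv x \<otimes> y)" using geo by (simp add: gp_def)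
  also have "\<dots> \<le> len (inv x \<otimes> p i) + len (inv (p i) \<otimes> y)"
    using len_diff_le[of x "p i" y] x y p by simp
  also have "len (inv (p i) \<otimes> y) \<le> len (inv (p i) \<otimes> q j) + len (inv (q j) \<otimes> y)"
    using len_diff_le[of "p i" "q j" y] x y p q by simp
  also have "wl (inv x \<otimes> p i) = wl (inv (p i) \<otimes> x)"
    using wl_inv[of "inv x \<otimes> p i"] p x by (simp add: inv_mult_group)
  finally have "len x + len y \<le> len (inv (p i) \<otimes> x) + (len (inv (p i) \<otimes> q j) + len (inv (q j) \<otimes> y))"
    by simp
  moreover have "wl (inv (p i) \<otimes> x) = wl x - i" "wl (inv (q j) \<otimes> y) = wl y - j"
    using p(4)[of i "wl x"] p(2)[of "wl x"] i q(4)[of j "wl y"] q(2)[of "wl y"] j by simp_all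
  ultimately have 2: "real i \<le> K * (2 * E)" using 1 i(1) j(1) by linarith
  have "z = \<psi> (p i) \<otimes> inv (inv z \<otimes> \<psi> (p i))" using z p by (simp add: inv_mult_group)
  then have "len z \<le> len (\<psi> (p i)) + len (inv z \<otimes> \<psi> (p i))"
    using len_mult_le[of "\<psi> (p i)" "inv (inv z \<otimes> \<psi> (p i))"] z p
    by (metis hom.hom_closed inv_closed m_closed wl_inv)
  moreover have "wl (p i) = i" using p(4)[of 0 i] i p(1,3) by simp
  then have "len (\<psi> (p i)) \<le> K * (K * (2 * E))"
    using K(1)[of "p i"] p(3) mult_left_mono[OF 2 K(3)] by simp
  ultimately have "D \<le> K * (K * (2 * E)) + E + 1" using i(2) lz by linarith
  then show ?thesis by (simp add: D_def E_def algebra_simps)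
qed

text \<open>A weak form of the stability of quasi-geodesics; the logarithmic error saves the
  argument that removes it.\<close>
lemma image_gp_le:
  assumes \<psi>: "\<psi> \<in> iso G G"
  shows "\<exists>a\<ge>0. \<exists>b\<ge>0. \<forall>x\<in>carrier G. \<forall>y\<in>carrier G. \<forall>k. wl x \<le> 2 ^ k \<longrightarrow> wl y \<le> 2 ^ k \<longrightarrow>
    gp (\<psi> x) (\<psi> y) \<le> a * gp x y + b * real k + b"
proof -
  interpret hom: group_hom G G \<psi>
    using \<psi> by unfold_locales (auto simp: iso_def)
  obtain K1 where K1: "K1 \<ge> 1" "\<forall>x\<in>carrier G. len (\<psi> x) \<le> K1 * len x"
    using iso_lipschitz[OF \<psi>] by blast
  obtain K2 where K2: "K2 \<ge> 1" "\<forall>x\<in>carrier G. len x \<le> K2 * len (\<psi> x)"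
    using iso_len_le[OF \<psi>] by blast
  define K where "K = max K1 K2"
  have K0: "K \<ge> 0" using K1 by (simp add: K_def)
  have KA: "len (\<psi> x) \<le> K * len x" and KB: "len x \<le> K * len (\<psi> x)" if "x \<in> carrier G" for x
  proof -
    have "K1 * len x \<le> K * len x" "K2 * len (\<psi> x) \<le> K * len (\<psi> x)"
      by (auto intro!: mult_right_mono simp: K_def)
    then show "len (\<psi> x) \<le> K * len x" "len x \<le> K * len (\<psi> x)"
      using K1(2) K2(2) that order_trans by blast+
  qed
  define a where "a = 2 * K * K + 1"
  define b where "b = K * (1 + 2 * \<delta>) + a * (2 * \<delta> + K) + 1"
  have a: "a \<ge> 0" using K0 by (simp add: a_def)
  have "gp (\<psi> x) (\<psi> y) \<le> K * gp x y + b * real k + b"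
    if x: "x \<in> carrier G" "wl x \<le> 2 ^ k" and y: "y \<in> carrier G" "wl y \<le> 2 ^ k" for x y k
  proof -
    let ?d = "inv x \<otimes> y"
    \<comment> \<open>\<open>t\<close> is the distance from \<open>x\<close> to the centre of the
      triangle \<open>\<one>\<close>, \<open>x\<close>, \<open>y\<close>, measured along the side
      from \<open>x\<close> to \<open>y\<close>.\<close>
    define t where "t = gp (inv x) ?d"
    have t: "t = (len x + len ?d - len y) / 2" using x y by (simp add: t_def gp_def)
    have "0 \<le> t" using gp_nonneg x y by (simp add: t_def)
    have "gp ?d (inv x) \<le> len ?d" using gp_le_left x y by simp
    then have "t \<le> len ?d" using x y gp_commute[of "inv x" ?d] by (simp add: t_def)
    then have nt: "nat \<lfloor>t\<rfloor> \<le> wl ?d" using \<open>0 \<le> t\<close> by linarith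
    then obtain p q where pq: "p \<in> carrier G" "q \<in> carrier G" "?d = p \<otimes> q" "wl p = nat \<lfloor>t\<rfloor>"
      "wl q = wl ?d - nat \<lfloor>t\<rfloor>"
      using ex_split[of ?d "nat \<lfloor>t\<rfloor>"] x y by auto
    have lp: "len p \<le> t" "t \<le> len p + 1" and lq: "len q = len ?d - len p"
      using pq \<open>0 \<le> t\<close> nt by linarith+
    have geo: "gp (inv p) q = 0" using len_mult[OF pq(1), of q] pq(3) lq by simp
    \<comment> \<open>\<open>w\<close> is the centre up to rounding. Seen from \<open>w\<close>, the
      vertices \<open>x\<close> and \<open>y\<close> are \<open>inv p\<close> and \<open>q\<close>,
      to which \<open>image_gp_geodesic\<close> applies; the translation costs
      \<open>len (\<psi> w)\<close>.\<close>
    define w where "w = x \<otimes> p"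
    have w: "w \<in> carrier G" "x = w \<otimes> inv p" "y = w \<otimes> q"
    proof -
      show "y = w \<otimes> q" using x y pq(1-3) by (simp add: w_def m_assoc pq(3)[symmetric])
    qed (use x pq in \<open>simp_all add: w_def m_assoc\<close>)
    \<comment> \<open>So \<open>inv w\<close> has product at most \<delta> with \<open>inv p\<close>
      or with \<open>q\<close>. Either case bounds \<open>len w\<close> by
      \<open>gp x y + (1 + 2 * \<delta>)\<close>, the 1 coming from rounding
      \<open>t\<close>.\<close>
    have "min (gp (inv p) (inv w)) (gp (inv w) q) \<le> \<delta>"
      using four_point[of "inv p" q "inv w"] geo pq w by simp
    moreover have "gp (inv p) (inv w) = (len p + len w - len x) / 2"
    proof -
      have "inv (inv p) \<otimes> inv w = inv x" using x pq by (simp add: w_def inv_mult_group)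
      then show ?thesis using x pq w(1) by (simp add: gp_def)
    qed
    moreover have "gp (inv w) q = (len w + len q - len y) / 2"
      using w pq by (simp add: gp_def)
    ultimately have lw: "len w \<le> gp x y + (1 + 2 * \<delta>)"
      using lp lq t by (simp add: gp_def min_def field_simps split: if_splits)
    have "wl ?d \<le> 2 ^ Suc k" using wl_mult_le[of "inv x" y] x y by simp
    then have "wl (inv p) \<le> 2 ^ Suc k" "wl q \<le> 2 ^ Suc k" using pq nt by simp_all
    then have "gp (\<psi> (inv p)) (\<psi> q) \<le> a * (\<delta> + K + real (Suc k) * \<delta>) + 1"
      unfolding a_def using image_gp_geodesic[OF \<psi> KA KB K0 _ _ _ _ geo, of "Suc k"] pq by simp
    moreover have "gp (\<psi> x) (\<psi> y) \<le> len (\<psi> w) + gp (\<psi> (inv p)) (\<psi> q)"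
      using gp_translate_le[of "\<psi> w" "\<psi> (inv p)" "\<psi> q"] w pq by simp
    moreover have "len (\<psi> w) \<le> K * gp x y + K * (1 + 2 * \<delta>)"
      using KA[OF w(1)] mult_left_mono[OF lw K0] by (simp add: distrib_left)
    ultimately have "gp (\<psi> x) (\<psi> y) \<le> K * gp x y + b + a * \<delta> * real k"
      by (simp add: b_def algebra_simps)
    moreover have "a * \<delta> \<le> b"
      using K0 a delta_nonneg by (simp add: b_def algebra_simps)
    then have "a * \<delta> * real k \<le> b * real k" by (intro mult_right_mono) auto
    ultimately show ?thesis by linarith
  qed
  moreover have "b \<ge> 0" using K0 a delta_nonneg by (simp add: b_def)
  ultimately show ?thesis using K0 by blast
qed

text \<open>For linearly bounded sequences the exponent \<open>k\<close> in
  \<open>image_gp_le\<close> can be taken logarithmic in \<open>n\<close>, so its contribution is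
  sublinear.\<close>

lemma sublinear_on_image_gp:
  assumes \<psi>: "\<psi> \<in> iso G G" and x: "lin_bounded A x" and y: "lin_bounded A y"
    and sub: "sublinear_on A (\<lambda>n. gp (x n) (y n))"
  shows "sublinear_on A (\<lambda>n. gp (\<psi> (x n)) (\<psi> (y n)))"
proof -
  obtain a b where ab: "a \<ge> 0" "b \<ge> 0" and bcl: "\<And>x y k. x \<in> carrier G \<Longrightarrow> y \<in> carrier G \<Longrightarrow>
      wl x \<le> 2 ^ k \<Longrightarrow> wl y \<le> 2 ^ k \<Longrightarrow> gp (\<psi> x) (\<psi> y) \<le> a * gp x y + b * real k + b"
    using image_gp_le[OF \<psi>] by blast
  obtain \<Lambda> where \<Lambda>: "\<Lambda> \<ge> 1" "\<And>n. n \<in> A \<Longrightarrow> x n \<in> carrier G"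
    "\<And>n. n \<in> A \<Longrightarrow> len (x n) \<le> \<Lambda> * (real n + 1)" using lin_boundedD[OF x] by metis
  obtain M where M: "M \<ge> 1" "\<And>n. n \<in> A \<Longrightarrow> y n \<in> carrier G"
    "\<And>n. n \<in> A \<Longrightarrow> len (y n) \<le> M * (real n + 1)" using lin_boundedD[OF y] by metis
  define L where "L = \<Lambda> + M"
  have L: "L \<ge> 1" "L > 0" using \<Lambda> M by (simp_all add: L_def)
  have log: "sublinear_on A (\<lambda>n. real (LEAST k. L * (real n + 1) \<le> 2 ^ k))"
    unfolding sublinear_on_def
  proof safe
    fix \<epsilon> :: real assume e: "\<epsilon> > 0"
    \<comment> \<open>With this \<open>j\<close> and \<open>i + 1 \<le> 2 ^ i\<close>, the exponent
      \<open>?i + j\<close> suffices for every \<open>n\<close>.\<close>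
    obtain j where j: "L * (1 + 1 / \<epsilon>) < 2 ^ j"
      using real_arch_pow[of 2 "L * (1 + 1 / \<epsilon>)"] by auto
    have "real (LEAST k. L * (real n + 1) \<le> 2 ^ k) \<le> \<epsilon> * real n + real j" for n
    proof -
      let ?i = "nat \<lfloor>\<epsilon> * real n\<rfloor>"
      have i: "real ?i \<le> \<epsilon> * real n" "\<epsilon> * real n < real ?i + 1"
        using e by (simp_all add: of_nat_nat)
      have "real ?i + 1 \<le> 2 ^ ?i"
        using of_nat_mono[OF Suc_leI[OF less_exp[of ?i]], where 'a = real] by simp
      have "real n \<le> (real ?i + 1) / \<epsilon>" using i e by (simp add: field_simps)
      then have "real n + 1 \<le> (real ?i + 1) * (1 + 1 / \<epsilon>)"
        by (simp add: distrib_left add_divide_distrib)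
      then have "L * (real n + 1) \<le> L * ((real ?i + 1) * (1 + 1 / \<epsilon>))"
        using L by (intro mult_left_mono) auto
      also have "\<dots> = (real ?i + 1) * (L * (1 + 1 / \<epsilon>))" by (rule mult.left_commute)
      also have "\<dots> \<le> 2 ^ ?i * 2 ^ j"
        using j L e \<open>real ?i + 1 \<le> 2 ^ ?i\<close> by (intro mult_mono) auto
      finally have "(LEAST k. L * (real n + 1) \<le> 2 ^ k) \<le> ?i + j"
        by (intro Least_le) (simp add: power_add)
      then show ?thesis using i(1) by linarith
    qed
    then show "\<exists>B. \<forall>n\<in>A. real (LEAST k. L * (real n + 1) \<le> 2 ^ k) \<le> \<epsilon> * real n + B" by blast
  qed
  have "gp (\<psi> (x n)) (\<psi> (y n))
      \<le> a * gp (x n) (y n) + b * real (LEAST k. L * (real n + 1) \<le> 2 ^ k) + b" if n: "n \<in> A" for n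
  proof (rule bcl[OF \<Lambda>(2)[OF n] M(2)[OF n]])
    let ?k = "LEAST k. L * (real n + 1) \<le> 2 ^ k"
    obtain j where "L * (real n + 1) < 2 ^ j"
      using real_arch_pow[of 2 "L * (real n + 1)"] by auto
    then have "L * (real n + 1) \<le> 2 ^ j" by simp
    then have k: "L * (real n + 1) \<le> 2 ^ ?k" by (rule LeastI)
    have "len (x n) \<le> 2 ^ ?k" "len (y n) \<le> 2 ^ ?k"
    proof -
      have "\<Lambda> * (real n + 1) \<le> L * (real n + 1)" "M * (real n + 1) \<le> L * (real n + 1)"
        using \<Lambda>(1) M(1) by (auto intro!: mult_right_mono simp: L_def)
      then show "len (x n) \<le> 2 ^ ?k" "len (y n) \<le> 2 ^ ?k"
        using \<Lambda>(3)[OF n] M(3)[OF n] k by linarith+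
    qed
    then show "wl (x n) \<le> 2 ^ ?k" "wl (y n) \<le> 2 ^ ?k"
      using of_nat_le_iff[where 'a = real, of _ "2 ^ ?k"] by simp_all
  qed
  moreover have "sublinear_on A (\<lambda>n. a * gp (x n) (y n)
      + b * real (LEAST k. L * (real n + 1) \<le> 2 ^ k) + b)"
    by (intro sublinear_on_add sublinear_on_cmult sub log ab sublinear_on_const)
  ultimately show ?thesis by (rule sublinear_on_mono[rotated])
qed

end

section \<open>Powers and translation lengths\<close>

context fin_gen_group
begin

text \<open>For a group element \<open>x\<close> this says that the translation length, the limit of
  \<open>len (x [^] n) / n\<close>, is at least \<kappa>. The constant \<open>B\<close> absorbs the
  change under conjugation.\<close>

definition lin_growth :: "real \<Rightarrow> 'a \<Rightarrow> bool" where
  "lin_growth \<kappa> x \<longleftrightarrow> (\<exists>B. \<forall>n::nat. \<kappa> * real n - B \<le> len (x [^] n))"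

lemma lin_growth_mono:
  assumes "lin_growth \<kappa> x" "\<kappa>' \<le> \<kappa>"
  shows "lin_growth \<kappa>' x"
proof -
  obtain B where B: "\<And>n::nat. \<kappa> * real n - B \<le> len (x [^] n)"
    using assms(1) unfolding lin_growth_def by blast
  have "\<kappa>' * real n - B \<le> len (x [^] n)" for n :: nat
    using B[of n] mult_right_mono[OF assms(2), of "real n"] by simp
  then show ?thesis unfolding lin_growth_def by blast
qed

lemma lin_growth_conj:
  assumes "lin_growth \<kappa> x" "x \<in> carrier G" "p \<in> carrier G"
  shows "lin_growth \<kappa> (inv p \<otimes> x \<otimes> p)"
proof -
  obtain B where B: "\<And>n::nat. \<kappa> * real n - B \<le> len (x [^] n)"
    using assms(1) unfolding lin_growth_def by blast
  have pow: "(inv p \<otimes> x \<otimes> p) [^] n = inv p \<otimes> (x [^] n \<otimes> p)" for n :: nat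
    using assms(2,3) by (induction n) (simp_all add: m_assoc)
  have "\<kappa> * real n - (B + 2 * len p) \<le> len ((inv p \<otimes> x \<otimes> p) [^] n)" for n :: nat
  proof -
    let ?y = "inv p \<otimes> (x [^] n \<otimes> p)"
    have "x [^] n = p \<otimes> (?y \<otimes> inv p)" using assms(2,3) by (simp add: m_assoc)
    then have "len (x [^] n) \<le> len p + (len ?y + len p)"
      using len_mult_le[of p "?y \<otimes> inv p"] len_mult_le[of ?y "inv p"] assms(2,3) by simp
    then show ?thesis using B[of n] pow[of n] by simp
  qed
  then show ?thesis unfolding lin_growth_def by blast
qed

text \<open>The rate obtained depends on \<psi>; \<open>uniform_lin_growth\<close> will turn its
  positivity into a common rate.\<close>

lemma lin_growth_iso:
  assumes "lin_growth \<kappa> x" "\<kappa> > 0" "x \<in> carrier G" and \<psi>: "\<psi> \<in> iso G G"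
  shows "\<exists>\<kappa>'>0. lin_growth \<kappa>' (\<psi> x)"
proof -
  interpret hom: group_hom G G \<psi>
    using \<psi> by unfold_locales (auto simp: iso_def)
  obtain B where B: "\<And>n::nat. \<kappa> * real n - B \<le> len (x [^] n)"
    using assms(1) unfolding lin_growth_def by blast
  obtain K where K: "K \<ge> 1" "\<And>x. x \<in> carrier G \<Longrightarrow> len x \<le> K * len (\<psi> x)"
    using iso_len_le[OF \<psi>] by blast
  have "\<kappa> / K * real n - B / K \<le> len (\<psi> x [^] n)" for n :: nat
  proof -
    have "\<psi> x [^] n = \<psi> (x [^] n)" using assms(3) by (simp add: hom.hom_nat_pow)
    then have "\<kappa> * real n - B \<le> K * len (\<psi> x [^] n)"
      using B[of n] K(2)[of "x [^] n"] assms(3) by simp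
    then show ?thesis using K(1) by (simp add: field_simps)
  qed
  moreover have "\<kappa> / K > 0" using K(1) assms(2) by simp
  ultimately show ?thesis unfolding lin_growth_def by blast
qed

text \<open>A shortest element of a right coset of the subgroup generated by \<open>h\<close>
  satisfies the last two inequalities. If all of these were short, a finite ball would meet every
  coset and the index would be finite.\<close>

lemma long_coset_representative:
  assumes "non_elementary G" "h \<in> carrier G"
  shows "\<exists>z\<in>carrier G. N \<le> len z \<and> len z \<le> len (h \<otimes> z) \<and> len z \<le> len (inv h \<otimes> z)"
proof (rule ccontr)
  assume neg: "\<not> ?thesis"
  let ?H = "generate G {h}"
  have sub: "subgroup ?H G" using assms(2) by (intro generate_is_subgroup) auto
  have h: "h \<in> ?H" "inv h \<in> ?H" by (auto intro: generate.intros)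
  have "rcosets ?H \<subseteq> (\<lambda>z. ?H #> z) ` {z \<in> carrier G. len z \<le> N}"
  proof
    fix C assume "C \<in> rcosets ?H"
    then obtain a where a: "a \<in> carrier G" "C = ?H #> a" by (auto simp: RCOSETS_def)
    have "a \<in> C" using a rcos_self[OF a(1) sub] by simp
    then obtain z where z: "z \<in> C" "\<And>y. y \<in> C \<Longrightarrow> wl z \<le> wl y"
      using ex_has_least_nat[of "\<lambda>z. z \<in> C" a wl] by blast
    obtain k where k: "k \<in> ?H" "z = k \<otimes> a" using z(1) a by (auto simp: r_coset_def)
    have kc: "k \<in> carrier G" using k(1) subgroup.mem_carrier[OF sub] by blast
    then have zc: "z \<in> carrier G" using k a by simp
    have "h' \<otimes> z \<in> C" if "h' \<in> ?H" for h'
    proof -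
      have "h' \<otimes> k \<in> ?H" using that k(1) subgroup.m_closed[OF sub] by blast
      moreover have "h' \<otimes> z = (h' \<otimes> k) \<otimes> a"
        using subgroup.mem_carrier[OF sub that] kc a k by (simp add: m_assoc)
      ultimately show ?thesis unfolding a(2) r_coset_def by blast
    qed
    then have "wl z \<le> wl (h \<otimes> z)" "wl z \<le> wl (inv h \<otimes> z)" using z(2) h by auto
    then have "len z \<le> N" using neg zc by force
    moreover have "C = ?H #> z" using z(1) a repr_independence[OF _ a(1) sub] by blast
    ultimately show "C \<in> (\<lambda>z. ?H #> z) ` {z \<in> carrier G. len z \<le> N}" using zc by blast
  qed
  then have "finite (rcosets ?H)" using finite_ball finite_subset finite_imageI by (metis (no_types))
  then show False using assms by (auto simp: non_elementary_def virtually_cyclic_def)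
qed

end

section \<open>Elements with little self-cancellation\<close>

context hyperbolic_group
begin

text \<open>By \<open>axial\<close>, less than half of \<open>h\<close> cancels in
  \<open>h \<otimes> h\<close>. Inductively \<open>h [^] Suc n\<close> follows \<open>h\<close> for
  longer than \<open>gp h (inv h) + \<delta>\<close>, so it cannot follow \<open>inv h\<close> that
  far.\<close>

lemma gp_inv_pow_le:
  assumes h: "h \<in> carrier G" and axial: "2 * gp h (inv h) + 2 * \<delta> + 1 \<le> len h"
  shows "gp (inv h) (h [^] (n::nat)) \<le> gp h (inv h) + \<delta>"
proof (induction n)
  case 0
  then show ?case using h gp_nonneg[of h "inv h"] delta_nonneg by simp
next
  case (Suc n)
  have "gp h (h [^] Suc n) = len h - gp (inv h) (h [^] n)"
    using gp_mult_right[of h "h [^] n"] h nat_pow_Suc2[OF h] by simp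
  then have "gp h (h [^] Suc n) > gp h (inv h) + \<delta>" using Suc axial by simp
  moreover have "min (gp (inv h) (h [^] Suc n)) (gp (h [^] Suc n) h) - \<delta> \<le> gp (inv h) h"
    using h by (intro four_point) auto
  moreover have "gp (inv h) h = gp h (inv h)" "gp (h [^] Suc n) h = gp h (h [^] Suc n)"
    using h by (auto intro!: gp_commute)
  ultimately show ?case by linarith
qed

lemma len_pow_ge:
  assumes h: "h \<in> carrier G" and axial: "2 * gp h (inv h) + 2 * \<delta> + 1 \<le> len h"
  shows "real n \<le> len (h [^] (n::nat))"
proof (induction n)
  case (Suc n)
  then show ?case
    using len_mult[OF h, of "h [^] n"] gp_inv_pow_le[OF assms, of n] axial nat_pow_Suc2[OF h] by simp
qed simp

lemma gp_pow_ge: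
  assumes h: "h \<in> carrier G" and axial: "2 * gp h (inv h) + 2 * \<delta> + 1 \<le> len h" and "n > 0"
  shows "len h - gp h (inv h) - \<delta> \<le> gp h (h [^] (n::nat))"
proof -
  obtain m where "n = Suc m" using \<open>n > 0\<close> gr0_conv_Suc by blast
  then show ?thesis
    using gp_mult_right[of h "h [^] m"] h nat_pow_Suc2[OF h] gp_inv_pow_le[OF assms(1,2), of m] by simp
qed

text \<open>\<open>h [^] n\<close> starts along \<open>h\<close> and its inverse along
  \<open>inv h\<close>, so by the five-point estimate their product exceeds
  \<open>gp h (inv h)\<close> by at most \<open>2 * \<delta>\<close>.\<close>

lemma gp_pow_inv_pow_le:
  assumes h: "h \<in> carrier G" and axial: "2 * gp h (inv h) + 4 * \<delta> + 1 \<le> len h"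
  shows "gp (h [^] (n::nat)) (inv (h [^] n)) \<le> gp h (inv h) + 2 * \<delta>"
proof (cases "n = 0")
  case True
  then show ?thesis using h gp_nonneg[of h "inv h"] delta_nonneg by simp
next
  case False
  have ax: "2 * gp h (inv h) + 2 * \<delta> + 1 \<le> len h" using axial delta_nonneg by simp
  have comm: "gp (inv h) h = gp h (inv h)" using h gp_commute by simp
  have "len h - gp h (inv h) - \<delta> \<le> gp h (h [^] n)" using gp_pow_ge[OF h ax] False by simp
  moreover have "len h - gp h (inv h) - \<delta> \<le> gp (inv h) (inv (h [^] n))"
    using gp_pow_ge[of "inv h" n] h ax False comm nat_pow_inv[OF h] by simp
  then have "len h - gp h (inv h) - \<delta> \<le> gp (inv (h [^] n)) (inv h)"
    using h gp_commute[of "inv h" "inv (h [^] n)"] by simp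
  ultimately show ?thesis
    using five_point[of h "h [^] n" "inv (h [^] n)" "inv h"] h axial delta_nonneg by simp
qed

text \<open>Cut a long geodesic as \<open>x = b \<otimes> c\<close>; one of \<open>b\<close>,
  \<open>c\<close>, \<open>x\<close> works. Otherwise \<open>x\<close> starts like its inverse, so
  \<open>b\<close> starts like \<open>inv c\<close>; since \<open>b\<close> and \<open>c\<close>
  also start like their inverses, \<open>inv b\<close> starts like \<open>c\<close>, and the
  geodesic product would cancel.\<close>

lemma ex_long_axial:
  assumes "infinite (carrier G)"
  shows "\<exists>h\<in>carrier G. N \<le> len h \<and> gp h (inv h) \<le> 4 * \<delta>"
proof -
  define n where "n = nat \<lceil>max N (4 * \<delta> + 1)\<rceil>"
  have n: "N \<le> real n" "4 * \<delta> < real n" by (simp_all add: n_def) linarith+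
  have "\<not> carrier G \<subseteq> {x \<in> carrier G. len x \<le> real (2 * n)}"
    using assms finite_ball finite_subset by blast
  then obtain x where x: "x \<in> carrier G" "wl x \<ge> 2 * n" by force
  then obtain b c where bc: "b \<in> carrier G" "c \<in> carrier G" "x = b \<otimes> c" "wl b = n" "wl c = wl x - n"
    using ex_split[of x n] by auto
  have 0: "gp (inv b) c = 0" using len_mult[of b c] bc x by simp
  have 1: "gp b x = len b" using gp_mult_right[of b c] bc 0 by simp
  have ix: "inv x = inv c \<otimes> inv b" using bc by (simp add: inv_mult_group)
  have 2: "gp (inv x) (inv c) = len c"
    using gp_mult_right[of "inv c" "inv b"] bc 0 ix gp_commute[of "inv x" "inv c"]
      gp_commute[of "inv b" c] x(1) by simp
  show ?thesis
  proof (rule ccontr)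
    assume "\<not> ?thesis"
    then have neg: "\<And>y. y \<in> carrier G \<Longrightarrow> wl y \<ge> n \<Longrightarrow> 4 * \<delta> < gp y (inv y)"
      using n by force
    have g: "gp b (inv b) > 4 * \<delta>" "gp c (inv c) > 4 * \<delta>" "gp x (inv x) > 4 * \<delta>"
      using bc x by (auto intro!: neg)
    have "gp b (inv c) > 2 * \<delta>"
      using five_point[of b x "inv x" "inv c"] 1 2 g n bc x by simp
    then have "gp (inv b) c > 0"
      using five_point[of "inv b" b "inv c" c] g bc delta_nonneg
        gp_commute[of b "inv b"] gp_commute[of c "inv c"] by simp
    then show False using 0 by simp
  qed
qed

text \<open>Moving the first half \<open>p\<close> of \<open>y\<close> to the end gives the
  conjugate \<open>q \<otimes> p\<close>. Were \<open>gp y (inv y)\<close> too large, so much would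
  cancel that its length is at most \<open>1 + 6 * \<delta>\<close>, against minimality.\<close>

lemma conj_minimal_axial:
  assumes y: "y \<in> carrier G" and min: "\<And>p. p \<in> carrier G \<Longrightarrow> len y \<le> len (inv p \<otimes> y \<otimes> p)"
    and long: "len y > 1 + 6 * \<delta>"
  shows "2 * gp y (inv y) + 2 * \<delta> + 1 \<le> len y"
proof (rule ccontr)
  assume neg: "\<not> ?thesis"
  obtain p q where pq: "p \<in> carrier G" "q \<in> carrier G" "y = p \<otimes> q" "wl p = wl y div 2"
    "wl q = wl y - wl y div 2" using ex_split[OF y, of "wl y div 2"] by auto
  have half: "(len y - 1) / 2 \<le> len p" "(len y - 1) / 2 \<le> len q" "len p + len q = len y"
  proof -
    have "wl y \<le> 2 * wl p + 1" "2 * wl p \<le> wl y" "wl p + wl q = wl y" unfolding pq(4,5) by auto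
    then have "len y \<le> 2 * len p + 1" "2 * len p \<le> len y" "len p + len q = len y"
      by (simp_all flip: of_nat_add)
    then show "(len y - 1) / 2 \<le> len p" "(len y - 1) / 2 \<le> len q" "len p + len q = len y"
      by (simp_all add: field_simps)
  qed
  have 0: "gp (inv p) q = 0" using len_mult[of p q] pq half by simp
  have 1: "gp y p = len p"
    using gp_mult_right[of p q] pq 0 gp_commute[of y p] y by simp
  have iy: "inv y = inv q \<otimes> inv p" using pq by (simp add: inv_mult_group)
  have 2: "gp (inv q) (inv y) = len q"
    using gp_mult_right[of "inv q" "inv p"] pq 0 iy gp_commute[of "inv p" q] by simp
  have "(len y - 1) / 2 - 3 * \<delta> \<le> gp (inv q) p"
    using five_point[of "inv q" "inv y" y p] 1 2 pq y half neg gp_commute[of y "inv y"] delta_nonneg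
    by (simp add: field_simps)
  moreover have "inv p \<otimes> y \<otimes> p = q \<otimes> p" using pq by (simp add: m_assoc)
  ultimately show False
    using len_mult[of q p] min[of p] pq half long by (simp add: field_simps)
qed

text \<open>Translation lengths are bounded away from zero: up to conjugacy only finitely many
  elements are too short for \<open>conj_minimal_axial\<close>.\<close>
lemma uniform_lin_growth:
  "\<exists>\<kappa>>0. \<forall>x\<in>carrier G. (\<exists>\<kappa>'>0. lin_growth \<kappa>' x) \<longrightarrow> lin_growth \<kappa> x"
proof -
  define Y where "Y = {y \<in> {y \<in> carrier G. len y \<le> 1 + 6 * \<delta>}. \<exists>\<kappa>>0. lin_growth \<kappa> y}"
  have fin: "finite Y" unfolding Y_def by (rule finite_subset[OF _ finite_ball]) auto
  have "\<forall>y\<in>Y. \<exists>\<kappa>>0. lin_growth \<kappa> y" by (auto simp: Y_def)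
  then obtain k where k: "\<And>y. y \<in> Y \<Longrightarrow> k y > 0 \<and> lin_growth (k y) y" by metis
  \<comment> \<open>1 is the rate \<open>len_pow_ge\<close> gives for long shortest conjugates; it
    also covers empty \<open>Y\<close>.\<close>
  define \<kappa> where "\<kappa> = Min (insert 1 (k ` Y))"
  have \<kappa>: "\<kappa> > 0" "\<kappa> \<le> 1" "\<And>y. y \<in> Y \<Longrightarrow> \<kappa> \<le> k y"
    using fin k by (auto simp: \<kappa>_def)
  have "lin_growth \<kappa> x" if x: "x \<in> carrier G" and gr: "\<kappa>' > 0" "lin_growth \<kappa>' x" for x \<kappa>'
  proof -
    obtain p where p: "p \<in> carrier G"
      "\<And>q. q \<in> carrier G \<Longrightarrow> wl (inv p \<otimes> x \<otimes> p) \<le> wl (inv q \<otimes> x \<otimes> q)"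
      using ex_has_least_nat[of "\<lambda>p. p \<in> carrier G" \<one> "\<lambda>p. wl (inv p \<otimes> x \<otimes> p)"] by blast
    define y where "y = inv p \<otimes> x \<otimes> p"
    have y: "y \<in> carrier G" "x = inv (inv p) \<otimes> y \<otimes> inv p"
      using p x by (simp_all add: y_def m_assoc)
    have min: "len y \<le> len (inv q \<otimes> y \<otimes> q)" if q: "q \<in> carrier G" for q
    proof -
      have "inv q \<otimes> y \<otimes> q = inv (p \<otimes> q) \<otimes> x \<otimes> (p \<otimes> q)"
        using p x q by (simp add: y_def m_assoc inv_mult_group)
      then show ?thesis using p(2)[of "p \<otimes> q"] p(1) q by (simp add: y_def)
    qed
    have "lin_growth \<kappa> y"
    proof (cases "len y \<le> 1 + 6 * \<delta>")
      case True
      then have "y \<in> Y" using lin_growth_conj[OF gr(2) x p(1)] gr(1) y(1) by (auto simp: Y_def y_def)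
      then show ?thesis using k \<kappa>(3) lin_growth_mono by blast
    next
      case False
      then have "lin_growth 1 y"
        using len_pow_ge[OF y(1) conj_minimal_axial[OF y(1) min]]
        unfolding lin_growth_def by (auto intro!: exI[of _ 0])
      then show ?thesis using \<kappa>(2) lin_growth_mono by blast
    qed
    then show ?thesis using lin_growth_conj[OF _ y(1), of \<kappa> "inv p"] y(2) p(1) by simp
  qed
  then show ?thesis using \<kappa>(1) by blast
qed

text \<open>The elements \<open>h [^] n\<close>, \<open>inv (h [^] n)\<close> and
  \<open>z \<otimes> w n\<close> diverge within bounded distance of \<open>\<one>\<close>:
  \<open>z\<close> is shortest under multiplication by \<open>h\<close> and \<open>inv h\<close>,
  and \<open>w n\<close> is a power that hardly cancels against \<open>z\<close>.\<close>

lemma three_directions: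
  assumes ne: "non_elementary G"
  shows "\<exists>h\<in>carrier G. \<exists>z\<in>carrier G. \<exists>K. \<exists>w::nat \<Rightarrow> 'a. lin_growth 1 h \<and>
    (\<forall>n. (w n = h [^] n \<or> w n = inv (h [^] n)) \<and> gp (h [^] n) (inv (h [^] n)) \<le> K \<and>
      gp (z \<otimes> w n) (h [^] n) \<le> K \<and> gp (z \<otimes> w n) (inv (h [^] n)) \<le> K)"
proof -
  have "infinite (carrier G)"
  proof
    assume "finite (carrier G)"
    then have "finite (Pow (carrier G))" by simp
    moreover have "rcosets (generate G {\<one>}) \<subseteq> Pow (carrier G)"
      using generate_incl[of "{\<one>}"] by (auto simp: RCOSETS_def r_coset_def)
    ultimately show False
      using ne one_closed finite_subset unfolding non_elementary_def virtually_cyclic_def by blast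
  qed
  then obtain h where h: "h \<in> carrier G" "16 * \<delta> + 1 \<le> len h" "gp h (inv h) \<le> 4 * \<delta>"
    using ex_long_axial by blast
  let ?t = "gp h (inv h)"
  have ax: "2 * ?t + 4 * \<delta> + 1 \<le> len h" "2 * ?t + 2 * \<delta> + 1 \<le> len h"
    using h delta_nonneg by linarith+
  define K where "K = len h + ?t + 2 * \<delta>"
  have t: "0 \<le> ?t" using gp_nonneg h by simp
  \<comment> \<open>Long enough for \<open>z \<otimes> w n\<close> to follow \<open>z\<close> beyond
    the point where \<open>z\<close> leaves the powers of \<open>h\<close>.\<close>
  obtain z where z: "z \<in> carrier G" "K + ?t + 5 * \<delta> + 1 \<le> len z"
    "len z \<le> len (h \<otimes> z)" "len z \<le> len (inv h \<otimes> z)"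
    using long_coset_representative[OF ne h(1)] by blast
  have pm: "gp (h [^] n) (inv (h [^] n)) \<le> ?t + 2 * \<delta>" for n :: nat
    using gp_pow_inv_pow_le[OF h(1) ax(1)] .
  \<comment> \<open>Here \<open>e\<close> is \<open>h\<close> or its inverse. Since
    \<open>inv e \<otimes> z\<close> is not shorter than \<open>z\<close>, \<open>z\<close> follows
    \<open>e\<close> for at most half of \<open>e\<close>, whereas a nontrivial \<open>x\<close>
    follows it further.\<close>
  have zh: "gp z x \<le> K"
    if x: "x \<in> carrier G" and e: "e \<in> carrier G" "len e = len h" "len z \<le> len (inv e \<otimes> z)"
      "x = \<one> \<or> len h - ?t - \<delta> \<le> gp e x" for x e
  proof (cases "x = \<one>")
    case True
    then show ?thesis using z(1) t h delta_nonneg by (simp add: K_def)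
  next
    case False
    have "gp e z \<le> len h / 2" using e by (simp add: gp_def)
    then have "gp z e \<le> len h / 2" using gp_commute z e by simp
    moreover have "min (gp z x) (gp x e) - \<delta> \<le> gp z e"
      using z x e by (intro four_point) auto
    moreover have "len h - ?t - \<delta> > len h / 2 + \<delta>" using ax h delta_nonneg by simp
    then have "gp x e > len h / 2 + \<delta>" using False e gp_commute[of e x] x by simp
    ultimately have "gp z x \<le> len h / 2 + \<delta>" by linarith
    then show ?thesis using t delta_nonneg by (simp add: K_def)
  qed
  have zp: "gp z (h [^] n) \<le> K" for n :: nat
    using gp_pow_ge[OF h(1) ax(2), of n] z h by (intro zh[of _ h]) (cases "n = 0"; simp)+
  have zm: "gp z (inv (h [^] n)) \<le> K" for n :: nat
  proof (rule zh[of _ "inv h"])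
    show "inv (h [^] n) = \<one> \<or> len h - ?t - \<delta> \<le> gp (inv h) (inv (h [^] n))"
      using gp_pow_ge[of "inv h" n] h ax nat_pow_inv[OF h(1)] gp_commute[of h "inv h"]
      by (cases "n = 0") simp_all
  qed (use z h in auto)
  \<comment> \<open>\<open>inv z\<close> cannot follow both of two diverging powers.\<close>
  have "\<exists>w. (w = h [^] n \<or> w = inv (h [^] n)) \<and> gp (inv z) w \<le> ?t + 3 * \<delta>" for n :: nat
  proof -
    have "min (gp (h [^] n) (inv z)) (gp (inv z) (inv (h [^] n))) - \<delta> \<le> ?t + 2 * \<delta>"
      using four_point[of "h [^] n" "inv (h [^] n)" "inv z"] pm[of n] h z by simp
    then have "gp (inv z) (h [^] n) \<le> ?t + 3 * \<delta> \<or> gp (inv z) (inv (h [^] n)) \<le> ?t + 3 * \<delta>"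
      using gp_commute[of "inv z" "h [^] n"] h z by (simp add: min_def split: if_splits)
    then show ?thesis by blast
  qed
  then obtain w where w: "\<And>n::nat. w n = h [^] n \<or> w n = inv (h [^] n)"
    "\<And>n. gp (inv z) (w n) \<le> ?t + 3 * \<delta>" by metis
  have wc: "w n \<in> carrier G" for n using w(1)[of n] h by auto
  have zw: "gp (z \<otimes> w n) x \<le> K + \<delta>" if x: "x \<in> carrier G" "gp z x \<le> K" for x n
  proof -
    have "gp z (z \<otimes> w n) \<ge> len z - ?t - 3 * \<delta>" using gp_mult_right[of z "w n"] w(2)[of n] z wc by simp
    moreover have "min (gp z (z \<otimes> w n)) (gp (z \<otimes> w n) x) - \<delta> \<le> gp z x"
      using z x wc by (intro four_point) auto
    ultimately show ?thesis using z(2) x(2) delta_nonneg by linarith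
  qed
  have "lin_growth 1 h"
    using len_pow_ge[OF h(1) ax(2)] unfolding lin_growth_def by (auto intro!: exI[of _ 0])
  moreover have "gp (h [^] n) (inv (h [^] n)) \<le> K + \<delta>" for n :: nat
    using pm[of n] delta_nonneg by (simp add: K_def)
  ultimately show ?thesis
    using h(1) z(1) w(1) zw[OF _ zp] zw[OF _ zm] by (metis inv_closed nat_pow_closed)
qed

end

section \<open>Almost fixed points\<close>

lemma iso_funpow:
  assumes "\<psi> \<in> iso G G"
  shows "\<psi> ^^ k \<in> iso G G"
proof (induction k)
  case 0
  show ?case using iso_set_refl[of G] by (simp add: id_def)
next
  case (Suc k)
  then show ?case using iso_set_trans[OF Suc.IH assms] by (simp add: comp_def)
qed

section \<open>Length bounds for almost fixed points\<close>

context fin_gen_group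
begin

text \<open>Applying \<open>\<theta> ^^ j\<close> to the equation for \<open>\<theta> (c n)\<close>
  adds two linearly bounded factors per step. The coefficient of \<open>len (c n)\<close> stays 1,
  which the comparison with the expansion factor needs.\<close>

lemma orbit_len_le:
  assumes \<theta>: "\<theta> \<in> iso G G" and ab: "lin_bounded A a" "lin_bounded A b"
    and c: "\<And>n. n \<in> A \<Longrightarrow> c n \<in> carrier G" "\<And>n. n \<in> A \<Longrightarrow> \<theta> (c n) = a n \<otimes> c n \<otimes> b n"
  shows "\<exists>\<Lambda>\<ge>0. \<forall>n\<in>A. len ((\<theta> ^^ j) (c n)) \<le> len (c n) + \<Lambda> * (real n + 1)"
proof (induction j)
  case 0
  show ?case by (intro exI[of _ 0]) simp
next
  case (Suc j)
  then obtain \<Lambda> where \<Lambda>: "\<Lambda> \<ge> 0" "\<And>n. n \<in> A \<Longrightarrow> len ((\<theta> ^^ j) (c n)) \<le> len (c n) + \<Lambda> * (real n + 1)"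
    by blast
  have iso: "\<theta> ^^ j \<in> iso G G" using iso_funpow[OF \<theta>] .
  interpret hom: group_hom G G "\<theta> ^^ j"
    using iso by unfold_locales (auto simp: iso_def)
  obtain M where M: "M \<ge> 1" "\<And>n. n \<in> A \<Longrightarrow> len ((\<theta> ^^ j) (a n)) \<le> M * (real n + 1)"
    using lin_boundedD[OF lin_bounded_iso[OF ab(1) iso]] by metis
  obtain N where N: "N \<ge> 1" "\<And>n. n \<in> A \<Longrightarrow> len ((\<theta> ^^ j) (b n)) \<le> N * (real n + 1)"
    using lin_boundedD[OF lin_bounded_iso[OF ab(2) iso]] by metis
  have "len ((\<theta> ^^ Suc j) (c n)) \<le> len (c n) + (\<Lambda> + M + N) * (real n + 1)" if n: "n \<in> A" for n
  proof -
    have cl: "a n \<in> carrier G" "b n \<in> carrier G" "c n \<in> carrier G"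
      using ab c(1) n by (auto simp: lin_bounded_def)
    have "(\<theta> ^^ Suc j) (c n) = (\<theta> ^^ j) (\<theta> (c n))" by (simp add: funpow_swap1)
    also have "\<dots> = (\<theta> ^^ j) (a n) \<otimes> (\<theta> ^^ j) (c n) \<otimes> (\<theta> ^^ j) (b n)"
      using c(2)[OF n] cl by simp
    finally have "len ((\<theta> ^^ Suc j) (c n))
        \<le> len ((\<theta> ^^ j) (a n)) + len ((\<theta> ^^ j) (c n)) + len ((\<theta> ^^ j) (b n))"
      using len_mult_le[of "(\<theta> ^^ j) (a n) \<otimes> (\<theta> ^^ j) (c n)" "(\<theta> ^^ j) (b n)"]
        len_mult_le[of "(\<theta> ^^ j) (a n)" "(\<theta> ^^ j) (c n)"] cl by simp
    then show ?thesis using \<Lambda>(2)[OF n] M(2)[OF n] N(2)[OF n] by (simp add: distrib_right)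
  qed
  moreover have "\<Lambda> + M + N \<ge> 0" using \<Lambda>(1) M(1) N(1) by simp
  ultimately show ?case by blast
qed

text \<open>Hyperbolicity of \<phi> enters here: forward and backward images of \<open>c n\<close>
  have length at most \<open>len (c n)\<close> plus O(n), yet one of them is at least
  \<open>q * len (c n)\<close> with \<open>q > 1\<close>.\<close>

lemma hyperbolic_aut_lin_bounded:
  assumes \<phi>: "\<phi> \<in> iso G G" "hyperbolic_aut G S \<phi>"
    and g: "lin_bounded A g" and b: "lin_bounded A b" and c: "\<And>n. n \<in> A \<Longrightarrow> c n \<in> carrier G"
    and eq: "\<And>n. n \<in> A \<Longrightarrow> \<phi> (c n) = inv (g n) \<otimes> c n \<otimes> b n"
  shows "lin_bounded A c"
proof -
  let ?\<phi>' = "inv_into (carrier G) \<phi>"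
  have \<phi>': "?\<phi>' \<in> iso G G" using iso_set_sym[OF \<phi>(1)] .
  interpret hom: group_hom G G ?\<phi>'
    using \<phi>' by unfold_locales (auto simp: iso_def)
  interpret hom': group_hom G G \<phi>
    using \<phi>(1) by unfold_locales (auto simp: iso_def)
  obtain m :: nat and q :: real where q: "q > 1" "\<And>x. x \<in> carrier G \<Longrightarrow>
      q * len x \<le> max (len ((\<phi> ^^ m) x)) (len ((?\<phi>' ^^ m) x))"
    using \<phi>(2) unfolding hyperbolic_aut_def by blast
  obtain \<Lambda> where \<Lambda>: "\<Lambda> \<ge> 0" "\<And>n. n \<in> A \<Longrightarrow> len ((\<phi> ^^ m) (c n)) \<le> len (c n) + \<Lambda> * (real n + 1)"
    using orbit_len_le[OF \<phi>(1) lin_bounded_inv[OF g] b c eq] by blast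
  have eq': "?\<phi>' (c n) = ?\<phi>' (g n) \<otimes> c n \<otimes> ?\<phi>' (inv (b n))" if n: "n \<in> A" for n
  proof -
    have cl: "g n \<in> carrier G" "b n \<in> carrier G" "c n \<in> carrier G"
      using g b c n by (auto simp: lin_bounded_def)
    then have "c n = g n \<otimes> \<phi> (c n) \<otimes> inv (b n)" using eq[OF n] by (simp add: m_assoc)
    moreover have "?\<phi>' (\<phi> (c n)) = c n" using \<phi>(1) cl by (simp add: iso_def bij_betw_def)
    ultimately show ?thesis using cl hom.hom_mult by (metis hom'.hom_closed inv_closed m_closed)
  qed
  obtain M where M: "M \<ge> 0" "\<And>n. n \<in> A \<Longrightarrow> len ((?\<phi>' ^^ m) (c n)) \<le> len (c n) + M * (real n + 1)"
    using orbit_len_le[OF \<phi>' lin_bounded_iso[OF g \<phi>'] lin_bounded_iso[OF lin_bounded_inv[OF b] \<phi>'] c eq']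
    by blast
  have "len (c n) \<le> (\<Lambda> + M) / (q - 1) * (real n + 1)" if n: "n \<in> A" for n
  proof -
    have "0 \<le> \<Lambda> * (real n + 1)" "0 \<le> M * (real n + 1)" using \<Lambda>(1) M(1) by simp_all
    then have "q * len (c n) \<le> len (c n) + (\<Lambda> + M) * (real n + 1)"
      using q(2)[OF c[OF n]] \<Lambda>(2)[OF n] M(2)[OF n] by (simp add: distrib_right)
    then show ?thesis using q(1) by (simp add: field_simps)
  qed
  then show ?thesis using c unfolding lin_bounded_def by blast
qed

end

section \<open>The test sequence and the descent along automorphism powers\<close>

context hyperbolic_group
begin

text \<open>Each of the nine index pairs violating the conclusion violates one of two inequalities;
  the first can fail at most once per row and the second at most once per column.\<close>
lemma ex_noncancelling_pair:
  assumes x: "\<And>i. x i \<in> carrier G" and y: "\<And>i. y i \<in> carrier G"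
    and K: "\<And>i j::nat. i < j \<Longrightarrow> j < 3 \<Longrightarrow> gp (x i) (x j) \<le> K"
    and s: "\<And>i j::nat. i < j \<Longrightarrow> j < 3 \<Longrightarrow> gp (y i) (y j) \<le> s"
  shows "\<exists>i<3. \<exists>j<3. gp (inv (x i)) (x j) \<le> K + \<delta> \<and> gp (inv (x j)) (y i) \<le> s + \<delta>"
proof (rule ccontr)
  assume neg: "\<not> ?thesis"
  define P where "P i j \<longleftrightarrow> K + \<delta> < gp (inv (x i)) (x j)" for i j
  define Q where "Q i j \<longleftrightarrow> s + \<delta> < gp (inv (x j)) (y i)" for i j
  have or: "P i j \<or> Q i j" if "i < 3" "j < 3" for i j
    using neg that unfolding P_def Q_def by (meson not_less)
  have row: "\<not> (P i j \<and> P i j')" if "j < j'" "j' < 3" for i j j'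
  proof -
    have "gp (inv (x i)) (x j) = gp (x j) (inv (x i))" using x gp_commute by simp
    then show ?thesis
      using four_point[OF x[of j] x[of j'] inv_closed[OF x[of i]]] K[OF that] unfolding P_def by linarith
  qed
  have col: "\<not> (Q i j \<and> Q i' j)" if "i < i'" "i' < 3" for i i' j
  proof -
    have "gp (inv (x j)) (y i) = gp (y i) (inv (x j))" using x y gp_commute by simp
    then show ?thesis
      using four_point[OF y[of i] y[of i'] inv_closed[OF x[of j]]] s[OF that] unfolding Q_def by linarith
  qed
  show False
  proof -
    \<comment> \<open>Columns 0 and 1 suffice: of these six pairs \<open>P\<close> holds for at most
      three, one per row, and \<open>Q\<close> for at most two, one per column.\<close>
    have "P 0 0 \<or> Q 0 0" "P 1 0 \<or> Q 1 0" "P 2 0 \<or> Q 2 0" "P 0 1 \<or> Q 0 1" "P 1 1 \<or> Q 1 1" "P 2 1 \<or> Q 2 1"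
      by (intro or; simp)+
    moreover have "\<not> (P 0 0 \<and> P 0 1)" "\<not> (P 1 0 \<and> P 1 1)" "\<not> (P 2 0 \<and> P 2 1)"
      by (intro row; simp)+
    moreover have "\<not> (Q 0 0 \<and> Q 1 0)" "\<not> (Q 0 0 \<and> Q 2 0)" "\<not> (Q 1 0 \<and> Q 2 0)"
      "\<not> (Q 0 1 \<and> Q 1 1)" "\<not> (Q 0 1 \<and> Q 2 1)" "\<not> (Q 1 1 \<and> Q 2 1)"
      by (intro col; simp)+
    ultimately show False by argo
  qed
qed

text \<open>Take \<open>g n = u n \<otimes> v n\<close> with factors among the three directions.
  They are chosen so that little cancels between them and \<open>inv (v n)\<close>, along which
  \<open>inv (g n)\<close> starts, diverges from \<open>\<phi> (u n)\<close>, along which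
  \<open>\<phi> (g n)\<close> starts.\<close>

lemma ex_noncancelling_sequence:
  assumes ne: "non_elementary G" and \<phi>: "\<phi> \<in> iso G G"
  shows "\<exists>g \<kappa>. lin_bounded UNIV g \<and> \<kappa> > 0 \<and>
    (\<forall>\<psi>\<in>iso G G. sublinear_on UNIV (\<lambda>n. \<kappa> * real n - len (\<psi> (g n)))) \<and>
    sublinear_on UNIV (\<lambda>n. gp (inv (g n)) (\<phi> (g n)))"
proof -
  obtain h z K and w :: "nat \<Rightarrow> 'a" where h: "h \<in> carrier G" "lin_growth 1 h" and z: "z \<in> carrier G"
    and dirs: "\<forall>n. (w n = h [^] n \<or> w n = inv (h [^] n)) \<and> gp (h [^] n) (inv (h [^] n)) \<le> K \<and>
      gp (z \<otimes> w n) (h [^] n) \<le> K \<and> gp (z \<otimes> w n) (inv (h [^] n)) \<le> K"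
    using three_directions[OF ne] by (elim bexE exE conjE) (rule that; assumption)
  have w: "w n = h [^] n \<or> w n = inv (h [^] n)"
    and K: "gp (h [^] n) (inv (h [^] n)) \<le> K" "gp (z \<otimes> w n) (h [^] n) \<le> K"
      "gp (z \<otimes> w n) (inv (h [^] n)) \<le> K" for n
    using dirs by simp_all
  obtain \<kappa> where \<kappa>: "\<kappa> > 0"
    "\<And>x. x \<in> carrier G \<Longrightarrow> (\<exists>\<kappa>'>0. lin_growth \<kappa>' x) \<Longrightarrow> lin_growth \<kappa> x"
    using uniform_lin_growth by blast
  interpret phi: group_hom G G \<phi>
    using \<phi> by unfold_locales (auto simp: iso_def)
  have wc: "w n \<in> carrier G" for n using w[of n] h by auto
  define x where "x n i = (if i = 0 then h [^] n else if i = 1 then inv (h [^] n) else z \<otimes> w n)"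
    for n and i :: nat
  have xc: "x n i \<in> carrier G" for n i using h z wc by (simp add: x_def)
  \<comment> \<open>The index may vary with \<open>n\<close>, as the chosen pair will.\<close>
  have lb: "lin_bounded UNIV (\<lambda>n. x n (i n))" for i
  proof -
    have pow: "len (h [^] n) \<le> len h * real n" for n :: nat
    proof (induction n)
      case (Suc n)
      then show ?case using len_mult_le[of "h [^] n" h] h by (simp add: algebra_simps)
    qed simp
    have "len (x n (i n)) \<le> (len h + len z) * (real n + 1)" for n
    proof -
      have "wl (w n) = wl (h [^] n)" using w[of n] h by auto
      then have "len (x n (i n)) \<le> len z + len (h [^] n)"
        using len_mult_le[OF z wc[of n]] h by (simp add: x_def)
      moreover have "(len h + len z) * (real n + 1) = len h * real n + len h + len z * real n + len z"
        by (simp add: algebra_simps)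
      moreover have "0 \<le> len z * real n" "0 \<le> len h" by simp_all
      ultimately show ?thesis using pow[of n] by linarith
    qed
    then show ?thesis using xc unfolding lin_bounded_def by blast
  qed
  \<comment> \<open>The uniform rate is applied to \<open>\<psi> h\<close>, so only \<open>B\<close>
    depends on \<psi>.\<close>
  have low: "\<exists>B\<ge>0. \<forall>n i. \<kappa> * real n - B \<le> len (\<psi> (x n i))" if \<psi>: "\<psi> \<in> iso G G" for \<psi>
  proof -
    interpret hom: group_hom G G \<psi>
      using \<psi> by unfold_locales (auto simp: iso_def)
    have "lin_growth \<kappa> (\<psi> h)" using \<kappa>(2) lin_growth_iso[OF h(2) _ h(1) \<psi>] h(1) by simp
    then obtain B where B: "\<And>n::nat. \<kappa> * real n - B \<le> len (\<psi> h [^] n)"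
      unfolding lin_growth_def by blast
    have "\<kappa> * real n - (\<bar>B\<bar> + len (\<psi> z)) \<le> len (\<psi> (x n i))" for n i
    proof -
      have pow: "\<psi> (h [^] n) = \<psi> h [^] n" using h by (simp add: hom.hom_nat_pow)
      have "wl (\<psi> (w n)) = wl (\<psi> (h [^] n))" using w[of n] h by auto
      then have "len (\<psi> (w n)) = len (\<psi> h [^] n)" by (simp add: pow)
      moreover have "\<psi> (w n) = inv (\<psi> z) \<otimes> \<psi> (z \<otimes> w n)" using z wc by simp
      then have "len (\<psi> (w n)) \<le> len (\<psi> z) + len (\<psi> (z \<otimes> w n))"
        using len_mult_le[of "inv (\<psi> z)" "\<psi> (z \<otimes> w n)"] z wc by simp
      moreover have "B \<le> \<bar>B\<bar>" "0 \<le> len (\<psi> z)" by simp_all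
      ultimately have "\<kappa> * real n - (\<bar>B\<bar> + len (\<psi> z)) \<le> len (\<psi> h [^] n)"
        "\<kappa> * real n - (\<bar>B\<bar> + len (\<psi> z)) \<le> len (\<psi> (z \<otimes> w n))"
        using B[of n] pow by linarith+
      then show ?thesis using pow h by (simp add: x_def)
    qed
    then show ?thesis by (intro exI[of _ "\<bar>B\<bar> + len (\<psi> z)"]) simp
  qed
  define s where "s n = max (gp (\<phi> (x n 0)) (\<phi> (x n 1)))
      (max (gp (\<phi> (x n 0)) (\<phi> (x n 2))) (gp (\<phi> (x n 1)) (\<phi> (x n 2))))" for n
  have xK: "gp (x n i) (x n j) \<le> K" if "i < j" "j < 3" for n i j
  proof -
    have "(i, j) \<in> {(0, 1), (0, 2), (1, 2)}" using that by auto
    moreover have "gp (x n 0) (x n 1) \<le> K" "gp (x n 2) (x n 0) \<le> K" "gp (x n 2) (x n 1) \<le> K"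
      using K[of n] by (simp_all add: x_def)
    ultimately show ?thesis using gp_commute[OF xc[of n 2] xc[of n 0]] gp_commute[OF xc[of n 2] xc[of n 1]]
      by auto
  qed
  have sub_s: "sublinear_on UNIV s"
  proof -
    have "sublinear_on UNIV (\<lambda>n. gp (\<phi> (x n i)) (\<phi> (x n j)))" if "i < j" "j < 3" for i j
      by (rule sublinear_on_image_gp[OF \<phi> lb lb sublinear_on_mono[OF sublinear_on_const xK[OF that]]])
    then show ?thesis unfolding s_def by (intro sublinear_on_max) auto
  qed
  have xs: "gp (\<phi> (x n i)) (\<phi> (x n j)) \<le> s n" if "i < j" "j < 3" for n i j
  proof -
    have "(i, j) \<in> {(0, 1), (0, 2), (1, 2)}" using that by auto
    then show ?thesis by (auto simp: s_def)
  qed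
  have "\<exists>i j. gp (inv (x n i)) (x n j) \<le> K + \<delta> \<and> gp (inv (x n j)) (\<phi> (x n i)) \<le> s n + \<delta>" for n
    using ex_noncancelling_pair[of "x n" "\<lambda>i. \<phi> (x n i)" K "s n"] xc xK[of _ _ n] xs[of _ _ n] phi.hom_closed
    by blast
  then obtain i j where ij: "\<And>n. gp (inv (x n (i n))) (x n (j n)) \<le> K + \<delta>"
    "\<And>n. gp (inv (x n (j n))) (\<phi> (x n (i n))) \<le> s n + \<delta>" by metis
  define u where "u n = x n (i n)" for n
  define v where "v n = x n (j n)" for n
  define g where "g n = u n \<otimes> v n" for n
  have uc: "u n \<in> carrier G" and vc: "v n \<in> carrier G" for n using xc by (simp_all add: u_def v_def)
  have lbu: "lin_bounded UNIV u" and lbv: "lin_bounded UNIV v"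
    unfolding u_def v_def using lb by auto
  have suv: "sublinear_on UNIV (\<lambda>n. gp (\<psi> (inv (u n))) (\<psi> (v n)))" if "\<psi> \<in> iso G G" for \<psi>
    using ij(1) by (intro sublinear_on_image_gp[OF that lin_bounded_inv[OF lbu] lbv]
        sublinear_on_mono[OF sublinear_on_const]) (simp add: u_def v_def)
  have "sublinear_on UNIV (\<lambda>n. \<kappa> * real n - len (\<psi> (g n)))" if \<psi>: "\<psi> \<in> iso G G" for \<psi>
  proof -
    interpret hom: group_hom G G \<psi>
      using \<psi> by unfold_locales (auto simp: iso_def)
    obtain B where B: "\<And>n i. \<kappa> * real n - B \<le> len (\<psi> (x n i))" using low[OF \<psi>] by blast
    have "\<kappa> * real n - len (\<psi> (g n)) \<le> B + 2 * gp (\<psi> (inv (u n))) (\<psi> (v n))" for n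
      using len_mult[of "\<psi> (u n)" "\<psi> (v n)"] B[of n "i n"] uc[of n] vc[of n]
      by (simp add: g_def u_def[symmetric])
    moreover have "sublinear_on UNIV (\<lambda>n. B + 2 * gp (\<psi> (inv (u n))) (\<psi> (v n)))"
      by (intro sublinear_on_add sublinear_on_cmult suv[OF \<psi>] sublinear_on_const) simp
    ultimately show ?thesis by (rule sublinear_on_mono[rotated])
  qed
  moreover have "sublinear_on UNIV (\<lambda>n. gp (inv (g n)) (\<phi> (g n)))"
  proof -
    obtain B where B: "B \<ge> 0" "\<And>n i. \<kappa> * real n - B \<le> len (\<phi> (x n i))" using low[OF \<phi>] by blast
    obtain C where C: "C \<ge> 0" "\<And>n i. \<kappa> * real n - C \<le> len (x n i)"
      using low[OF iso_set_refl[of G]] by auto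
    define r where "r n = B + C + K + \<delta> + gp (\<phi> (inv (u n))) (\<phi> (v n))" for n
    have "K \<ge> 0" using K(1)[of 0] by simp
    \<comment> \<open>In the chain \<open>inv (v n)\<close>, \<open>inv (g n)\<close>,
      \<open>\<phi> (g n)\<close>, \<open>\<phi> (u n)\<close> the first and last products are at
      least \<open>\<kappa> * real n - r n\<close>, while the ends have small product; so the middle
      one must be small.\<close>
    have minr: "min (gp (inv (g n)) (\<phi> (g n))) (\<kappa> * real n - r n) \<le> s n + 3 * \<delta>" for n
    proof -
      have gc: "g n \<in> carrier G" using uc vc by (simp add: g_def)
      have "gp (inv (v n)) (inv (g n)) = len (v n) - gp (inv (u n)) (v n)"
        using gp_mult_right[of "inv (v n)" "inv (u n)"] uc vc gp_commute[of "v n" "inv (u n)"]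
        by (simp add: g_def inv_mult_group)
      then have "gp (inv (v n)) (inv (g n)) \<ge> \<kappa> * real n - C - (K + \<delta>)"
        using C(2)[of n "j n"] ij(1)[of n] by (simp add: u_def v_def)
      moreover have "gp (\<phi> (u n)) (\<phi> (g n)) = len (\<phi> (u n)) - gp (\<phi> (inv (u n))) (\<phi> (v n))"
        using gp_mult_right[of "\<phi> (u n)" "\<phi> (v n)"] uc vc by (simp add: g_def)
      then have "gp (\<phi> (g n)) (\<phi> (u n)) \<ge> \<kappa> * real n - B - gp (\<phi> (inv (u n))) (\<phi> (v n))"
        using B(2)[of n "i n"] gp_commute[of "\<phi> (u n)" "\<phi> (g n)"] uc gc by (simp add: u_def)
      moreover have "min (gp (inv (v n)) (inv (g n))) (min (gp (inv (g n)) (\<phi> (g n)))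
          (gp (\<phi> (g n)) (\<phi> (u n)))) - 2 * \<delta> \<le> s n + \<delta>"
        using five_point[of "inv (v n)" "inv (g n)" "\<phi> (g n)" "\<phi> (u n)"] ij(2)[of n] uc vc gc
        by (simp add: u_def v_def)
      moreover have "0 \<le> gp (\<phi> (inv (u n))) (\<phi> (v n))" using uc vc gp_nonneg by simp
      ultimately show ?thesis using B(1) C(1) \<open>K \<ge> 0\<close> delta_nonneg unfolding r_def by linarith
    qed
    have "sublinear_on UNIV r"
      unfolding r_def by (intro sublinear_on_add sublinear_on_const suv[OF \<phi>])
    then show ?thesis
      by (rule sublinear_on_min_linear[OF minr \<kappa>(1) _ sublinear_on_add[OF sub_s sublinear_on_const]])
  qed
  moreover have "lin_bounded UNIV g" unfolding g_def using lin_bounded_mult[OF lbu lbv] .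
  ultimately show ?thesis using \<kappa>(1) by blast
qed

text \<open>Each application of \<open>\<phi>\<close> shortens \<open>c n\<close> by almost \<open>\<kappa> * n\<close>; this can be repeated
  arbitrarily often, although \<open>c n\<close> has length \<open>O(n)\<close>.\<close>
lemma no_linear_descent:
  assumes inf: "infinite A" and \<phi>: "\<phi> \<in> iso G G"
    and g: "lin_bounded A g" and b: "\<And>n. n \<in> A \<Longrightarrow> b n \<in> carrier G" "\<And>n. n \<in> A \<Longrightarrow> len (b n) \<le> C"
    and c: "lin_bounded A c" and eq: "\<And>n. n \<in> A \<Longrightarrow> \<phi> (c n) = inv (g n) \<otimes> c n \<otimes> b n"
    and \<kappa>: "\<kappa> > 0" "\<And>\<psi>. \<psi> \<in> iso G G \<Longrightarrow> sublinear_on A (\<lambda>n. \<kappa> * real n - len (\<psi> (g n)))"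
    and sub: "sublinear_on A (\<lambda>n. gp (inv (g n)) (\<phi> (c n)))"
  shows False
proof -
  have gc: "g n \<in> carrier G" and cc: "c n \<in> carrier G" if "n \<in> A" for n
    using g c that by (auto simp: lin_bounded_def)
  interpret phi: group_hom G G \<phi>
    using \<phi> by unfold_locales (auto simp: iso_def)
  have descent: "sublinear_on A (\<lambda>n. real k * \<kappa> * real n + len ((\<phi> ^^ k) (c n)) - len (c n))" for k
  proof (induction k)
    case 0
    show ?case by simp
  next
    case (Suc k)
    let ?\<psi> = "\<phi> ^^ k"
    have \<psi>: "?\<psi> \<in> iso G G" using iso_funpow[OF \<phi>] .
    interpret hom: group_hom G G ?\<psi>
      using \<psi> by unfold_locales (auto simp: iso_def)
    obtain M where M: "M \<ge> 1" "\<And>x. x \<in> carrier G \<Longrightarrow> len (?\<psi> x) \<le> M * len x"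
      using iso_lipschitz[OF \<psi>] by blast
    \<comment> \<open>Compare lengths in \<open>?\<psi> (g n) \<otimes> ?\<psi> (\<phi> (c n)) =
      ?\<psi> (c n) \<otimes> ?\<psi> (b n)\<close>; the left side has sublinear cancellation and
      \<open>?\<psi> (b n)\<close> is bounded.\<close>
    have step: "\<kappa> * real n + len ((\<phi> ^^ Suc k) (c n)) - len (?\<psi> (c n))
        \<le> (\<kappa> * real n - len (?\<psi> (g n))) + 2 * gp (?\<psi> (inv (g n))) (?\<psi> (\<phi> (c n))) + M * C"
      if n: "n \<in> A" for n
    proof -
      have cl: "g n \<in> carrier G" "b n \<in> carrier G" "c n \<in> carrier G" using gc cc b n by auto
      have "?\<psi> (g n) \<otimes> ?\<psi> (\<phi> (c n)) = ?\<psi> (c n) \<otimes> ?\<psi> (b n)"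
        using eq[OF n] cl by (simp add: m_assoc)
      moreover have "len (?\<psi> (c n) \<otimes> ?\<psi> (b n)) \<le> len (?\<psi> (c n)) + len (?\<psi> (b n))"
        using cl by (intro len_mult_le) auto
      moreover have "len (?\<psi> (b n)) \<le> M * C"
        using M(2)[OF cl(2)] mult_left_mono[OF b(2)[OF n], of M] M(1) by linarith
      moreover have "(\<phi> ^^ Suc k) (c n) = ?\<psi> (\<phi> (c n))" by (simp add: funpow_swap1)
      ultimately show ?thesis
        using len_mult[of "?\<psi> (g n)" "?\<psi> (\<phi> (c n))"] cl by simp
    qed
    have "sublinear_on A (\<lambda>n. gp (?\<psi> (inv (g n))) (?\<psi> (\<phi> (c n))))"
      by (rule sublinear_on_image_gp[OF \<psi> lin_bounded_inv[OF g] lin_bounded_iso[OF c \<phi>] sub])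
    then have "sublinear_on A (\<lambda>n. (\<kappa> * real n - len (?\<psi> (g n)))
        + 2 * gp (?\<psi> (inv (g n))) (?\<psi> (\<phi> (c n))) + M * C)"
      by (intro sublinear_on_add sublinear_on_cmult \<kappa>(2)[OF \<psi>] sublinear_on_const) auto
    from sublinear_on_add[OF this Suc.IH] show ?case
    proof (rule sublinear_on_mono)
      fix n assume "n \<in> A"
      then show "real (Suc k) * \<kappa> * real n + len ((\<phi> ^^ Suc k) (c n)) - len (c n)
        \<le> (\<kappa> * real n - len (?\<psi> (g n))) + 2 * gp (?\<psi> (inv (g n))) (?\<psi> (\<phi> (c n))) + M * C
          + (real k * \<kappa> * real n + len (?\<psi> (c n)) - len (c n))"
        using step[of n] by (simp add: algebra_simps)
    qed
  qed
  obtain \<Lambda> where \<Lambda>: "\<And>n. n \<in> A \<Longrightarrow> len (c n) \<le> \<Lambda> * (real n + 1)"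
    using lin_boundedD[OF c] by metis
  \<comment> \<open>After \<open>k\<close> steps the loss would exceed the linear bound on
    \<open>len (c n)\<close> by a positive multiple of \<open>n\<close>.\<close>
  obtain k :: nat where k: "\<Lambda> + 1 < real k * \<kappa>"
    using reals_Archimedean3[OF \<kappa>(1)] by blast
  have "1 * real n \<le> real k * \<kappa> * real n + len ((\<phi> ^^ k) (c n)) - len (c n) + \<Lambda>" if n: "n \<in> A" for n
    using \<Lambda>[OF n] mult_right_mono[OF less_imp_le[OF k], of "real n"] by (simp add: algebra_simps)
  then have "sublinear_on A (\<lambda>n. 1 * real n)"
    by (rule sublinear_on_mono[OF sublinear_on_add[OF descent[of k] sublinear_on_const]])
  then show False using not_sublinear_on_linear[OF inf, of 1] by simp
qed

text \<open>Finitely many classes have representatives of bounded length, so every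
  \<open>g n\<close> is twisted conjugate, through some \<open>c n\<close>, to a bounded
  \<open>b n\<close>. The four-point condition then allows the descent for \<phi> or for its
  inverse.\<close>

lemma infinite_reidemeister_classes:
  assumes ne: "non_elementary G" and \<phi>: "\<phi> \<in> iso G G" "hyperbolic_aut G S \<phi>"
  shows "infinite (reidemeister_classes G \<phi>)"
proof
  assume fin: "finite (reidemeister_classes G \<phi>)"
  let ?\<phi>' = "inv_into (carrier G) \<phi>"
  have \<phi>': "?\<phi>' \<in> iso G G" using iso_set_sym[OF \<phi>(1)] .
  interpret hom: group_hom G G \<phi>
    using \<phi>(1) by unfold_locales (auto simp: iso_def)
  interpret hom': group_hom G G ?\<phi>'
    using \<phi>' by unfold_locales (auto simp: iso_def)
  have "\<forall>Q\<in>reidemeister_classes G \<phi>. \<exists>a\<in>carrier G. Q = twisted_conj G \<phi> `` {a}"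
    by (auto simp: reidemeister_classes_def quotient_def)
  then obtain rep where rep: "\<And>Q. Q \<in> reidemeister_classes G \<phi> \<Longrightarrow>
      rep Q \<in> carrier G \<and> Q = twisted_conj G \<phi> `` {rep Q}" by metis
  obtain C where C: "\<And>Q. Q \<in> reidemeister_classes G \<phi> \<Longrightarrow> len (rep Q) \<le> C"
    using finite_image_bound[OF finite_imageI[OF fin, of rep]] by auto
  have ex: "\<exists>c\<in>carrier G. len (inv c \<otimes> g \<otimes> \<phi> c) \<le> C" if g: "g \<in> carrier G" for g
  proof -
    let ?Q = "twisted_conj G \<phi> `` {g}"
    have Q: "?Q \<in> reidemeister_classes G \<phi>"
      using g by (auto simp: reidemeister_classes_def quotient_def)
    have "(g, g) \<in> twisted_conj G \<phi>"
      using g by (auto simp: twisted_conj_def intro!: bexI[of _ \<one>])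
    then have "(rep ?Q, g) \<in> twisted_conj G \<phi>" using rep[OF Q] by blast
    then obtain c where c: "c \<in> carrier G" "g = c \<otimes> rep ?Q \<otimes> inv (\<phi> c)"
      by (auto simp: twisted_conj_def)
    have "rep ?Q \<in> carrier G" using rep[OF Q] by blast
    then have "inv c \<otimes> (c \<otimes> rep ?Q \<otimes> inv (\<phi> c)) \<otimes> \<phi> c = rep ?Q"
      using c(1) by (simp add: m_assoc)
    then have "inv c \<otimes> g \<otimes> \<phi> c = rep ?Q" by (simp only: c(2)[symmetric])
    then show ?thesis using C[OF Q] c(1) by metis
  qed
  obtain g \<kappa> where g: "lin_bounded UNIV g" and \<kappa>: "\<kappa> > 0"
    "\<And>\<psi>. \<psi> \<in> iso G G \<Longrightarrow> sublinear_on UNIV (\<lambda>n. \<kappa> * real n - len (\<psi> (g n)))"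
    and sub: "sublinear_on UNIV (\<lambda>n. gp (inv (g n)) (\<phi> (g n)))"
    using ex_noncancelling_sequence[OF ne \<phi>(1)] by blast
  have gc: "g n \<in> carrier G" for n using g by (auto simp: lin_bounded_def)
  have "\<forall>n. \<exists>c\<in>carrier G. len (inv c \<otimes> g n \<otimes> \<phi> c) \<le> C" using ex gc by blast
  then obtain c where c: "\<And>n. c n \<in> carrier G" "\<And>n. len (inv (c n) \<otimes> g n \<otimes> \<phi> (c n)) \<le> C"
    by metis
  define b where "b n = inv (c n) \<otimes> g n \<otimes> \<phi> (c n)" for n
  have b: "b n \<in> carrier G" "len (b n) \<le> C" for n using c gc by (simp_all add: b_def)
  have eq: "\<phi> (c n) = inv (g n) \<otimes> c n \<otimes> b n" for n
    using c(1) gc by (simp add: b_def m_assoc)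
  have lc: "lin_bounded UNIV c"
    using hyperbolic_aut_lin_bounded[OF \<phi> g lin_bounded_bounded[of UNIV b C]] b c(1) eq by blast
  \<comment> \<open>\<open>A\<close> records which of the two products is the smaller;
    \<open>A\<close> or its complement is infinite.\<close>
  define A where "A = {n. gp (inv (g n)) (\<phi> (c n)) \<le> gp (\<phi> (g n)) (\<phi> (c n))}"
  have min: "min (gp (inv (g n)) (\<phi> (c n))) (gp (\<phi> (g n)) (\<phi> (c n)))
      \<le> gp (inv (g n)) (\<phi> (g n)) + \<delta>" for n
    using four_point[of "inv (g n)" "\<phi> (g n)" "\<phi> (c n)"] gp_commute[of "\<phi> (g n)" "\<phi> (c n)"]
      gc[of n] c(1)[of n] by simp
  have subd: "sublinear_on UNIV (\<lambda>n. gp (inv (g n)) (\<phi> (g n)) + \<delta>)"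
    by (intro sublinear_on_add sub sublinear_on_const)
  have "infinite A \<or> infinite (- A)"
    by (metis Compl_partition finite_Un infinite_UNIV_nat)
  then show False
  proof
    assume inf: "infinite A"
    have "sublinear_on A (\<lambda>n. gp (inv (g n)) (\<phi> (c n)))"
    proof (rule sublinear_on_mono[OF sublinear_on_subset[OF subd subset_UNIV]])
      fix n assume "n \<in> A"
      then show "gp (inv (g n)) (\<phi> (c n)) \<le> gp (inv (g n)) (\<phi> (g n)) + \<delta>"
        using min[of n] by (simp add: A_def min_def)
    qed
    then show False
      by (intro no_linear_descent[OF inf \<phi>(1) lin_bounded_subset[OF g subset_UNIV], of b C c \<kappa>]
          b lin_bounded_subset[OF lc subset_UNIV] eq \<kappa>(1) sublinear_on_subset[OF \<kappa>(2) subset_UNIV])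
  next
    assume inf: "infinite (- A)"
    have "sublinear_on (- A) (\<lambda>n. gp (\<phi> (g n)) (\<phi> (c n)))"
    proof (rule sublinear_on_mono[OF sublinear_on_subset[OF subd subset_UNIV]])
      fix n assume "n \<in> - A"
      then show "gp (\<phi> (g n)) (\<phi> (c n)) \<le> gp (inv (g n)) (\<phi> (g n)) + \<delta>"
        using min[of n] by (simp add: A_def min_def)
    qed
    \<comment> \<open>Two applications of the inverse of \<phi> produce the hypothesis of
      \<open>no_linear_descent\<close> for that inverse, with \<open>?\<phi>' (inv (g n))\<close> in
      place of \<open>g n\<close>.\<close>
    then have "sublinear_on (- A) (\<lambda>n. gp ((?\<phi>' \<circ> ?\<phi>') (\<phi> (g n))) ((?\<phi>' \<circ> ?\<phi>') (\<phi> (c n))))"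
      by (rule sublinear_on_image_gp[OF iso_set_trans[OF \<phi>' \<phi>']
          lin_bounded_iso[OF lin_bounded_subset[OF g subset_UNIV] \<phi>(1)]
          lin_bounded_iso[OF lin_bounded_subset[OF lc subset_UNIV] \<phi>(1)]])
    moreover have inv_phi: "?\<phi>' (\<phi> y) = y" if "y \<in> carrier G" for y
      using \<phi>(1) that by (simp add: iso_def bij_betw_def)
    ultimately have sub': "sublinear_on (- A) (\<lambda>n. gp (inv (?\<phi>' (inv (g n)))) (?\<phi>' (c n)))"
      using gc c(1) by simp
    obtain M where M: "M \<ge> 1" "\<And>x. x \<in> carrier G \<Longrightarrow> len (?\<phi>' x) \<le> M * len x"
      using iso_lipschitz[OF \<phi>'] by blast
    \<comment> \<open>Composing \<psi> with \<open>?\<phi>'\<close> gives another automorphism, and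
      \<kappa> is the same for all of them.\<close>
    have lin': "sublinear_on (- A) (\<lambda>n. \<kappa> * real n - len (\<psi> (?\<phi>' (inv (g n)))))"
      if \<psi>: "\<psi> \<in> iso G G" for \<psi>
    proof -
      interpret hom'': group_hom G G \<psi>
        using \<psi> by unfold_locales (auto simp: iso_def)
      show ?thesis
        using sublinear_on_subset[OF \<kappa>(2)[OF iso_set_trans[OF \<phi>' \<psi>]] subset_UNIV[of "- A"]] gc by simp
    qed
    have eq': "?\<phi>' (c n) = inv (?\<phi>' (inv (g n))) \<otimes> c n \<otimes> ?\<phi>' (inv (b n))" for n
    proof -
      have "c n = g n \<otimes> \<phi> (c n) \<otimes> inv (b n)" using eq[of n] c(1) gc b(1) by (simp add: m_assoc)
      then have "?\<phi>' (c n) = ?\<phi>' (g n \<otimes> \<phi> (c n) \<otimes> inv (b n))" by simp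
      also have "\<dots> = ?\<phi>' (g n) \<otimes> c n \<otimes> ?\<phi>' (inv (b n))"
        using c(1) gc b(1) inv_phi by simp
      finally show ?thesis using gc by simp
    qed
    have b': "len (?\<phi>' (inv (b n))) \<le> M * C" for n
    proof -
      have "len (?\<phi>' (inv (b n))) \<le> M * len (b n)" using M(2)[of "inv (b n)"] b(1)[of n] by simp
      also have "\<dots> \<le> M * C" using b(2)[of n] M(1) by (intro mult_left_mono) auto
      finally show ?thesis .
    qed
    show False
      by (rule no_linear_descent[OF inf \<phi>'
            lin_bounded_iso[OF lin_bounded_inv[OF lin_bounded_subset[OF g subset_UNIV]] \<phi>']
            _ b' lin_bounded_subset[OF lc subset_UNIV] eq' \<kappa>(1) lin' sub']) (use b(1) in simp)
  qed
qed

end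

theorem theorem1:
  fixes G (structure) and S :: "'a set" and \<phi> :: "'a \<Rightarrow> 'a"
  assumes "group G"
    and "fin_gen_set G S"
    and "gromov_hyperbolic_group G S"
    and "non_elementary G"
    and "\<phi> \<in> iso G G"
    and "hyperbolic_aut G S \<phi>"
  shows "infinite (reidemeister_classes G \<phi>)"
proof -
  interpret fin_gen_group G S
    using assms(1,2) by (simp add: fin_gen_group_def fin_gen_group_axioms_def)
  obtain \<delta> :: real where \<delta>: "\<delta> \<ge> 0" "\<forall>w\<in>carrier G. \<forall>x\<in>carrier G. \<forall>y\<in>carrier G. \<forall>z\<in>carrier G.
      gromov_prod G S w x y \<ge> min (gromov_prod G S w x z) (gromov_prod G S w y z) - \<delta>"
    using assms(3) unfolding gromov_hyperbolic_group_def by blast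
  have gp: "gromov_prod G S \<one> x y = gp x y" if "x \<in> carrier G" "y \<in> carrier G" for x y
    using that by (simp add: gromov_prod_def word_dist_def gp_def)
  interpret hyperbolic_group G S \<delta>
  proof unfold_locales
    fix x y z assume "x \<in> carrier G" "y \<in> carrier G" "z \<in> carrier G"
    then show "min (gp x z) (gp z y) - \<delta> \<le> gp x y"
      using \<delta>(2)[rule_format, OF one_closed, of x y z] gp_commute[of y z] by (simp add: gp)
  qed (rule \<delta>(1))
  show ?thesis using infinite_reidemeister_classes assms(4-6) by blast
qed

end
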